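(* For every $D\in\mathbb{N}$ there exist constants $R_1=R_1(D)$ and $C_1=C_1(D)$, depending only on $D$, such that the following holds. Let $G=(V,E,F)$ be a connected infinite penny graph with $\sup_{\sigma\in F}\deg(\sigma)=D$, let $\mathcal{T}$ be an associated triangulation of $\mathbb{R}^2$ for $G$, and for $f:V\to\mathbb{R}$ let $E(f)$ be the piecewise linear interpolation of $f$ with respect to $\mathcal{T}$. Then for any $R\geq R_1$, any $p\in\mathbb{R}^2$ and any harmonic function $f$ on $G$, $$E(f)^2(p)\leq\frac{C_1}{R^2}\int_{D_{R}(p)}E(f)^2(y)\,dy,$$ where $D_R(p)$ is the disk of radius $R$ centered at $p$ in $\mathbb{R}^2$.
   Context: Penny graphs. Let $\{C_i\}_{i=1}^\infty$ be an infinite collection of circles of radius $\frac12$ in $\mathbb{R}^2$ bounding open disks that are pairwise disjoint. The penny graph of this configuration is the graph $(V,E)$ with one vertex $v_i$ for each circle $C_i$, and $\{v_i,v_j\}\in E$ if and only if $C_i$ and $C_j$ are tangent. Placing $v_i$ at the center of $C_i$ and each edge as the straight segment joining the two centers embeds $(V,E)$ in $\mathbb{R}^2$; vertices and edges are identified with their images. The set $F$ of faces consists of the connected components of the complement in $\mathbb{R}^2$ of the embedded graph, and $G=(V,E,F)$ is called an infinite penny graph. It is connected if $(V,E)$ is connected. For $\sigma\in F$, the facial degree $\deg(\sigma)\in\mathbb{N}\cup\{\infty\}$ is the number of interior angles (corners) of the polygonal domain $\sigma$ (counted with multiplicity, i.e. along the boundary walk, which may have self-intersections). Harmonic functions. $\Delta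 f(x)=\sum_{y\sim x}(f(y)-f(x))$ for $f:V\to\mathbb{R}$, the sum being over neighbours of $x$; $f$ is harmonic on $G$ if $\Delta f\equiv0$ on $V$. Associated triangulation. Fix once and for all a function $D\mapsto C_0(D)\in[1,\infty)$ such that every connected infinite penny graph with $\sup_{\sigma\in F}\deg(\sigma)=D<\infty$ admits a triangulation as described next. An associated triangulation of $\mathbb{R}^2$ for $G$ is a geometric triangulation $\mathcal{T}=(V',E',F')$ of $\mathbb{R}^2$ with vertex set $V'=V$, obtained by triangulating every face $\sigma\in F$ using only the edges of $\sigma$ and diagonal segments of $\sigma$ (segments $[v,w]\subset\overline\sigma$ between vertices $v,w\in V$ of $\sigma$ that are not edges and satisfy $[v,w]\cap V=\{v,w\}$), and such that for every triangle of $F'$ all angles are at least $1/C_0(D)$ and all side lengths lie in $[1,C_0(D)]$. Interpolation. For $f:V\to\mathbb{R}$, $E(f):\mathbb{R}^2\to\mathbb{R}$ is the continuous function that agrees with $f$ on $V$ and is affine on each closed triangle of $\mathcal{T}$. *)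

theory Defs
  imports "HOL-Analysis.Analysis"
begin

section \<open>Infinite penny graphs\<close>

text \<open>A configuration of circles of radius \<open>1/2\<close> is given by the set \<open>V\<close> of its centres, which
  are also the vertices of the penny graph.  Disjointness of the disks makes \<open>V\<close> countable, so an
  infinite \<open>V\<close> is the same as a configuration indexed by the natural numbers.\<close>

definition infinite_penny_config :: "(real^2) set \<Rightarrow> bool" where
  "infinite_penny_config V \<longleftrightarrow>
     infinite V \<and> pairwise (\<lambda>u v. disjnt (ball u (1/2)) (ball v (1/2))) V"

text \<open>Tangency of two circles: they have exactly one common point.\<close>

definition penny_adj :: "(real^2) set \<Rightarrow> real^2 \<Rightarrow> real^2 \<Rightarrow> bool" where
  "penny_adj V u v \<longleftrightarrow>
     u \<in> V \<and> v \<in> V \<and> u \<noteq> v \<and> is_singleton (sphere u (1/2) \<inter> sphere v (1/2))"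

definition penny_connected :: "(real^2) set \<Rightarrow> bool" where
  "penny_connected V \<longleftrightarrow> (\<forall>u\<in>V. \<forall>v\<in>V. (penny_adj V)\<^sup>*\<^sup>* u v)"

definition penny_skeleton :: "(real^2) set \<Rightarrow> (real^2) set" where
  "penny_skeleton V = V \<union> \<Union>{closed_segment u v | u v. penny_adj V u v}"

definition penny_faces :: "(real^2) set \<Rightarrow> (real^2) set set" where
  "penny_faces V = components (- penny_skeleton V)"

text \<open>An edge not incident to a vertex \<open>v\<close> has distance at least \<open>sqrt 3 / 2\<close> from \<open>v\<close>.  Hence
  inside \<open>ball v (1/2)\<close> the embedded graph consists of the radii lying on the edges at \<open>v\<close>, and
  the components of \<open>\<sigma> \<inter> ball v (1/2)\<close> are the open sectors between cyclically consecutive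
  edges at \<open>v\<close> that belong to \<open>\<sigma>\<close>.  Each such sector is one interior angle of \<open>\<sigma>\<close>: a vertex
  passed several times by the boundary walk contributes one sector for each passage (an end vertex of
  degree one contributes a single full angle, and straight angles count).\<close>

definition face_corners :: "(real^2) set \<Rightarrow> (real^2) set \<Rightarrow> ((real^2) \<times> (real^2) set) set" where
  "face_corners V \<sigma> = {(v, S). v \<in> V \<and> S \<in> components (\<sigma> \<inter> ball v (1/2))}"

definition facial_degree :: "(real^2) set \<Rightarrow> (real^2) set \<Rightarrow> enat" where
  "facial_degree V \<sigma> =
     (if finite (face_corners V \<sigma>) then enat (card (face_corners V \<sigma>)) else \<infinity>)"

text \<open>Connected infinite penny graphs with supremum of the facial degrees equal to \<open>D\<close>.\<close>

definition connected_penny_graph :: "nat \<Rightarrow> (real^2) set \<Rightarrow> bool" where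
  "connected_penny_graph D V \<longleftrightarrow>
     infinite_penny_config V \<and> penny_connected V \<and>
     (SUP \<sigma>\<in>penny_faces V. facial_degree V \<sigma>) = enat D"


section \<open>Harmonic functions\<close>

text \<open>Functions on \<open>V\<close> are represented by functions on the plane whose values outside \<open>V\<close> are
  irrelevant.  The sum is finite since a vertex has at most six neighbours.\<close>

definition penny_laplacian :: "(real^2) set \<Rightarrow> (real^2 \<Rightarrow> real) \<Rightarrow> real^2 \<Rightarrow> real" where
  "penny_laplacian V f x = (\<Sum>y | penny_adj V x y. f y - f x)"

definition penny_harmonic :: "(real^2) set \<Rightarrow> (real^2 \<Rightarrow> real) \<Rightarrow> bool" where
  "penny_harmonic V f \<longleftrightarrow> (\<forall>x\<in>V. penny_laplacian V f x = 0)"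


section \<open>Associated triangulations\<close>

text \<open>A triangle is given by the set \<open>K\<close> of its three vertices; the closed triangle is
  \<open>convex hull K\<close>.  The library's notion of triangulation only covers finite families.\<close>

definition plane_triangulation :: "(real^2) set \<Rightarrow> (real^2) set set \<Rightarrow> bool" where
  "plane_triangulation V \<T> \<longleftrightarrow>
     (\<forall>K\<in>\<T>. card K = 3 \<and> \<not> affine_dependent K) \<and>
     (\<forall>K\<in>\<T>. \<forall>K'\<in>\<T>. convex hull K \<inter> convex hull K' = convex hull (K \<inter> K')) \<and>
     (\<Union>K\<in>\<T>. convex hull K) = UNIV \<and>
     \<Union>\<T> = V"

definition face_vertices :: "(real^2) set \<Rightarrow> (real^2) set \<Rightarrow> (real^2) set" where
  "face_vertices V \<sigma> = V \<inter> frontier \<sigma>"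

definition face_edge :: "(real^2) set \<Rightarrow> (real^2) set \<Rightarrow> real^2 \<Rightarrow> real^2 \<Rightarrow> bool" where
  "face_edge V \<sigma> v w \<longleftrightarrow> penny_adj V v w \<and> closed_segment v w \<subseteq> frontier \<sigma>"

definition face_diagonal :: "(real^2) set \<Rightarrow> (real^2) set \<Rightarrow> real^2 \<Rightarrow> real^2 \<Rightarrow> bool" where
  "face_diagonal V \<sigma> v w \<longleftrightarrow>
     v \<in> face_vertices V \<sigma> \<and> w \<in> face_vertices V \<sigma> \<and> v \<noteq> w \<and> \<not> penny_adj V v w \<and>
     closed_segment v w \<subseteq> closure \<sigma> \<and> closed_segment v w \<inter> V = {v, w}"

text \<open>Every face is subdivided into triangles whose sides are edges and diagonals of that face.
  The triangle has to lie in \<open>\<sigma>\<close> up to its boundary; containment in \<open>closure \<sigma>\<close> would allow it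
  to cross an edge that has \<open>\<sigma>\<close> on both sides.\<close>

definition triangulates_faces :: "(real^2) set \<Rightarrow> (real^2) set set \<Rightarrow> bool" where
  "triangulates_faces V \<T> \<longleftrightarrow>
     (\<forall>\<sigma>\<in>penny_faces V. closure \<sigma> = (\<Union>K\<in>{K\<in>\<T>. interior (convex hull K) \<subseteq> \<sigma>}. convex hull K)) \<and>
     (\<forall>K\<in>\<T>. \<exists>\<sigma>\<in>penny_faces V. interior (convex hull K) \<subseteq> \<sigma> \<and>
        (\<forall>v\<in>K. \<forall>w\<in>K. v \<noteq> w \<longrightarrow> face_edge V \<sigma> v w \<or> face_diagonal V \<sigma> v w))"

text \<open>The angle at \<open>b\<close> of the triangle \<open>a b c\<close>.\<close>

definition triangle_angle :: "real^2 \<Rightarrow> real^2 \<Rightarrow> real^2 \<Rightarrow> real" where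
  "triangle_angle a b c = arccos (((a - b) \<bullet> (c - b)) / (norm (a - b) * norm (c - b)))"

definition associated_triangulation :: "real \<Rightarrow> (real^2) set \<Rightarrow> (real^2) set set \<Rightarrow> bool" where
  "associated_triangulation C V \<T> \<longleftrightarrow>
     plane_triangulation V \<T> \<and> triangulates_faces V \<T> \<and>
     (\<forall>a b c. {a, b, c} \<in> \<T> \<longrightarrow> 1 / C \<le> triangle_angle a b c \<and> dist a b \<in> {1..C})"


section \<open>Piecewise linear interpolation\<close>

definition is_interpolation ::
    "(real^2) set \<Rightarrow> (real^2) set set \<Rightarrow> (real^2 \<Rightarrow> real) \<Rightarrow> (real^2 \<Rightarrow> real) \<Rightarrow> bool" where
  "is_interpolation V \<T> f g \<longleftrightarrow>
     continuous_on UNIV g \<and> (\<forall>v\<in>V. g v = f v) \<and>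
     (\<forall>K\<in>\<T>. \<exists>a b. \<forall>x\<in>convex hull K. g x = a \<bullet> x + b)"

definition interpolation ::
    "(real^2) set \<Rightarrow> (real^2) set set \<Rightarrow> (real^2 \<Rightarrow> real) \<Rightarrow> real^2 \<Rightarrow> real" where
  "interpolation V \<T> f = (THE g. is_interpolation V \<T> f g)"

end

theory Submission
  imports Defs
begin

text \<open>
  The proof uses that the plane is two-dimensional: a sum of gradients along the boundary of a
  square of side \<open>r\<close> has about \<open>r\<close> terms, so that by the Cauchy-Schwarz inequality the square of
  the oscillation there is at most a constant times \<open>r\<close> times the part of the Dirichlet energy that
  lives near this boundary.  Write \<open>g\<close> for the interpolation of the harmonic function \<open>f\<close>.

  \<^bold>\<open>Caccioppoli.\<close>  Testing harmonicity against a cutoff at scale \<open>M\<close> bounds the graph energy of \<open>f\<close>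
  in a disk of radius \<open>M\<close> by a multiple of \<open>1/M\<^sup>2\<close> times the sum of \<open>f\<^sup>2\<close> over the vertices of a disk about twice as
  large (\<open>harmonic_energy_bound\<close>).  As \<open>g\<close> is affine on fat triangles, that sum is controlled by
  the integral of \<open>g\<^sup>2\<close> (\<open>vertex_sum_le_integral\<close>).

  \<^bold>\<open>From edges to triangles.\<close>  The gradient of \<open>g\<close> on a triangle involves differences of \<open>f\<close> along
  diagonals of a face.  The boundary of a face is connected, because the embedded graph is, and
  carries at most \<open>D\<close> vertices, so the ends of a diagonal are joined by a path of bounded length
  along the face boundary (\<open>face_boundary_connected\<close>).  Hence the oscillation of \<open>g\<close> on a unit
  lattice cell is controlled by the graph energy nearby (\<open>interpolation_cell_oscillation\<close>).

  \<^bold>\<open>A good square.\<close>  Among the concentric squares around \<open>p\<close> of half side \<open>r\<close> with \<open>N \<le> r < 2N\<close> there is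
  one near whose boundary the energy and the integral of \<open>g\<^sup>2\<close> are at most their averages; on this
  boundary \<open>g\<^sup>2\<close> is at most a constant times \<open>1/N\<^sup>2\<close> times the integral of \<open>g\<^sup>2\<close> plus the energy
  (\<open>good_square\<close>, \<open>square_mean_value\<close>).

  \<^bold>\<open>Maximum principle.\<close>  The graph is infinite and connected, so \<open>f\<close> cannot be larger inside
  the square than \<open>g\<close> is on its boundary (\<open>maximum_principle\<close>).  This uses that \<open>g\<close> is affine along the
  edges of the graph, which holds because every edge is a side of a triangle
  (\<open>edge_is_side\<close>).  Taking \<open>N\<close> and \<open>M\<close> proportional to \<open>R\<close> gives the theorem.
\<close>

section \<open>Lattice points and packings in the plane\<close>

lemma int_interval_card:
  fixes a r :: real
  assumes "0 \<le> r"
  shows "finite {i::int. \<bar>of_int i - a\<bar> \<le> r}" (is "finite ?S")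
    and "real (card {i::int. \<bar>of_int i - a\<bar> \<le> r}) \<le> 2 * r + 1"
proof -
  have S: "?S = {\<lceil>a - r\<rceil>..\<lfloor>a + r\<rfloor>}"
    by (auto simp: abs_le_iff ceiling_le_iff le_floor_iff)
  show "finite ?S" unfolding S by simp
  have "real (card ?S) = max 0 (of_int \<lfloor>a + r\<rfloor> - of_int \<lceil>a - r\<rceil> + 1)"
    unfolding S by simp
  also have "\<dots> \<le> 2 * r + 1"
    using assms of_int_floor_le[of "a + r"] le_of_int_ceiling[of "a - r"] by linarith
  finally show "real (card ?S) \<le> 2 * r + 1" .
qed

lemma lattice_box_card:
  fixes a b r :: real
  assumes "0 \<le> r"
  shows "finite {q::int\<times>int. \<bar>of_int (fst q) - a\<bar> \<le> r \<and> \<bar>of_int (snd q) - b\<bar> \<le> r}" (is "finite ?S")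
    and "real (card {q::int\<times>int. \<bar>of_int (fst q) - a\<bar> \<le> r \<and> \<bar>of_int (snd q) - b\<bar> \<le> r})
           \<le> (2 * r + 1)\<^sup>2"
proof -
  have S: "?S = {i. \<bar>of_int i - a\<bar> \<le> r} \<times> {i. \<bar>of_int i - b\<bar> \<le> r}" by auto
  note ia = int_interval_card[OF assms, of a] and ib = int_interval_card[OF assms, of b]
  show "finite ?S" unfolding S using ia(1) ib(1) by simp
  have "real (card ?S) = real (card {i::int. \<bar>of_int i - a\<bar> \<le> r}) * real (card {i::int. \<bar>of_int i - b\<bar> \<le> r})"
    unfolding S by (simp add: card_cartesian_product)
  also have "\<dots> \<le> (2 * r + 1) * (2 * r + 1)"
    using ia(2) ib(2) assms by (intro mult_mono) auto
  finally show "real (card ?S) \<le> (2 * r + 1)\<^sup>2" by (simp add: power2_eq_square)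
qed

definition unit_separated :: "(real^2) set \<Rightarrow> bool" where
  "unit_separated V \<longleftrightarrow> (\<forall>u\<in>V. \<forall>v\<in>V. u \<noteq> v \<longrightarrow> 1 \<le> dist u v)"

lemma norm_sq_2: "(norm (x::real^2))\<^sup>2 = (x$1)\<^sup>2 + (x$2)\<^sup>2"
  by (simp add: norm_eq_sqrt_inner inner_vec_def sum_2 power2_eq_square)

text \<open>A square of side \<open>1/2\<close> has diameter less than \<open>1\<close>, so rounding \<open>2 v\<close> down to the integer lattice is
injective on a set with mutual distances at least \<open>1\<close>.\<close>

lemma unit_separated_packing:
  assumes "unit_separated V" "0 \<le> r"
  shows "finite (V \<inter> cball x r)" and "real (card (V \<inter> cball x r)) \<le> (4 * r + 3)\<^sup>2"
proof -
  define F where "F = (\<lambda>v::real^2. (\<lfloor>2 * v$1\<rfloor>, \<lfloor>2 * v$2\<rfloor>))"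
  define B where "B = {q::int\<times>int. \<bar>of_int (fst q) - 2 * x$1\<bar> \<le> 2 * r + 1 \<and> \<bar>of_int (snd q) - 2 * x$2\<bar> \<le> 2 * r + 1}"
  have inj: "inj_on F (V \<inter> cball x r)"
  proof (rule inj_onI)
    fix u v assume uv: "u \<in> V \<inter> cball x r" "v \<in> V \<inter> cball x r" "F u = F v"
    show "u = v"
    proof (rule ccontr)
      assume "u \<noteq> v"
      then have "1 \<le> dist u v" using uv assms(1) by (auto simp: unit_separated_def)
      have "\<lfloor>2 * u$1\<rfloor> = \<lfloor>2 * v$1\<rfloor>" "\<lfloor>2 * u$2\<rfloor> = \<lfloor>2 * v$2\<rfloor>" using uv(3) by (auto simp: F_def)
      then have "\<bar>u$1 - v$1\<bar> \<le> 1/2" "\<bar>u$2 - v$2\<bar> \<le> 1/2" by linarith+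
      then have "(u$1 - v$1)\<^sup>2 \<le> (1/2)\<^sup>2" "(u$2 - v$2)\<^sup>2 \<le> (1/2)\<^sup>2"
        by (metis abs_le_square_iff abs_of_pos half_gt_zero zero_less_one)+
      then have "(dist u v)\<^sup>2 \<le> (1/2)\<^sup>2 + (1/2)\<^sup>2"
        unfolding dist_norm norm_sq_2 by simp
      moreover have "1 \<le> (dist u v)\<^sup>2" using \<open>1 \<le> dist u v\<close> by (simp add: one_le_power)
      ultimately show False by (simp add: power2_eq_square)
    qed
  qed
  have sub: "F ` (V \<inter> cball x r) \<subseteq> B"
  proof
    fix q assume "q \<in> F ` (V \<inter> cball x r)"
    then obtain v where v: "v \<in> cball x r" "q = F v" by auto
    have "\<bar>v$1 - x$1\<bar> \<le> r" "\<bar>v$2 - x$2\<bar> \<le> r"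
      using component_le_norm_cart[of "v - x" 1] component_le_norm_cart[of "v - x" 2] v(1)
      by (auto simp: dist_norm norm_minus_commute)
    then show "q \<in> B" using v(2) unfolding B_def F_def
      by simp linarith
  qed
  have B: "finite B" "real (card B) \<le> (2 * (2 * r + 1) + 1)\<^sup>2"
    unfolding B_def using assms(2) by (intro lattice_box_card; simp)+
  show "finite (V \<inter> cball x r)"
    using finite_imageD[OF finite_subset[OF sub B(1)] inj] .
  have "card (V \<inter> cball x r) \<le> card B"
    using card_mono[OF B(1) sub] card_image[OF inj] by simp
  then show "real (card (V \<inter> cball x r)) \<le> (4 * r + 3)\<^sup>2"
    using B(2) by (simp add: algebra_simps)
qed

section \<open>Affine functions on fat triangles\<close>

definition cross2 :: "real^2 \<Rightarrow> real^2 \<Rightarrow> real" where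
  "cross2 u w = u$1 * w$2 - u$2 * w$1"

lemma cross2_sq: "(cross2 u w)\<^sup>2 = (norm u)\<^sup>2 * (norm w)\<^sup>2 - (u \<bullet> w)\<^sup>2"
  unfolding norm_sq_2 by (simp add: cross2_def inner_vec_def sum_2 power2_eq_square algebra_simps)

lemma abs_cross2_le: "\<bar>cross2 u w\<bar> \<le> norm u * norm w"
proof -
  have "(cross2 u w)\<^sup>2 \<le> (norm u * norm w)\<^sup>2" by (simp add: cross2_sq power_mult_distrib)
  then show ?thesis by (metis abs_le_square_iff abs_mult abs_norm_cancel)
qed

lemma cross2_expand: "cross2 u w *\<^sub>R z = cross2 z w *\<^sub>R u + cross2 u z *\<^sub>R w"
  by (simp add: vec_eq_iff forall_2 cross2_def algebra_simps)

text \<open>Expanding \<open>z\<close> in the basis \<open>u, w\<close> by Cramer's rule: a linear form is controlled by its values on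
two edge vectors of a triangle as soon as the triangle is not too thin.\<close>

lemma gradient_bound:
  "\<bar>cross2 u w\<bar> * \<bar>\<alpha> \<bullet> z\<bar> \<le> norm z * (norm w * \<bar>\<alpha> \<bullet> u\<bar> + norm u * \<bar>\<alpha> \<bullet> w\<bar>)"
proof -
  have "cross2 u w * (\<alpha> \<bullet> z) = cross2 z w * (\<alpha> \<bullet> u) + cross2 u z * (\<alpha> \<bullet> w)"
    using arg_cong[OF cross2_expand[of u w z], of "\<lambda>y. \<alpha> \<bullet> y"] by (simp add: inner_add_right)
  then have "\<bar>cross2 u w\<bar> * \<bar>\<alpha> \<bullet> z\<bar> = \<bar>cross2 z w * (\<alpha> \<bullet> u) + cross2 u z * (\<alpha> \<bullet> w)\<bar>"
    by (metis abs_mult)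
  also have "\<dots> \<le> \<bar>cross2 z w\<bar> * \<bar>\<alpha> \<bullet> u\<bar> + \<bar>cross2 u z\<bar> * \<bar>\<alpha> \<bullet> w\<bar>"
    by (metis abs_mult abs_triangle_ineq)
  also have "\<dots> \<le> (norm z * norm w) * \<bar>\<alpha> \<bullet> u\<bar> + (norm u * norm z) * \<bar>\<alpha> \<bullet> w\<bar>"
    by (intro add_mono mult_right_mono abs_cross2_le) auto
  finally show ?thesis by (simp add: algebra_simps)
qed

lemma affine_through_triangle:
  assumes "cross2 (b - a) (c - a) \<noteq> 0"
  shows "\<exists>\<alpha> \<beta>. \<alpha> \<bullet> a + \<beta> = (s::real) \<and> \<alpha> \<bullet> b + \<beta> = t \<and> \<alpha> \<bullet> c + \<beta> = r"
proof -
  define u w where "u = b - a" and "w = c - a"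
  define k where "k = cross2 u w"
  have k: "k \<noteq> 0" using assms by (simp add: k_def u_def w_def)
  \<comment> \<open>Cramer's rule for the two conditions on the edge vectors.\<close>
  define \<alpha> :: "real^2" where "\<alpha> = (1/k) *\<^sub>R vector [w$2 * (t - s) - u$2 * (r - s), u$1 * (r - s) - w$1 * (t - s)]"
  have "\<alpha> \<bullet> u = t - s" "\<alpha> \<bullet> w = r - s"
  proof -
    have "k * (\<alpha> \<bullet> u) = k * (t - s)" "k * (\<alpha> \<bullet> w) = k * (r - s)"
      using k by (simp_all add: \<alpha>_def inner_vec_def sum_2 vector_2 field_simps)
        (simp_all add: k_def cross2_def algebra_simps)
    then show "\<alpha> \<bullet> u = t - s" "\<alpha> \<bullet> w = r - s" using k by auto
  qed
  then have "\<alpha> \<bullet> a + (s - \<alpha> \<bullet> a) = s \<and> \<alpha> \<bullet> b + (s - \<alpha> \<bullet> a) = t \<and> \<alpha> \<bullet> c + (s - \<alpha> \<bullet> a) = r"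
    by (simp add: u_def w_def inner_diff_right)
  then show ?thesis by blast
qed

text \<open>For an acute angle, the lower bound on the angle is a lower bound on its sine, and the cross product
is that sine times two side lengths.  An obtuse angle close to \<open>\<pi>\<close> would spoil this.\<close>

lemma fat_triangle_cross2_acute:
  assumes C: "1 \<le> C" and ang: "1 / C \<le> triangle_angle a b c"
    and d: "1 \<le> dist a b" "1 \<le> dist b c" and acute: "0 \<le> (a - b) \<bullet> (c - b)"
  shows "sin (1 / C) \<le> \<bar>cross2 (a - b) (c - b)\<bar>"
proof -
  define n where "n = norm (a - b) * norm (c - b)"
  define t where "t = ((a - b) \<bullet> (c - b)) / n"
  have n: "1 \<le> n" using d mult_mono[of 1 "norm (a - b)" 1 "norm (c - b)"]
    by (simp add: n_def dist_norm norm_minus_commute)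
  have t0: "0 \<le> t" using acute n by (simp add: t_def)
  have t1: "t \<le> 1" using n norm_cauchy_schwarz[of "a - b" "c - b"] by (simp add: t_def n_def divide_le_eq)
  have inv: "0 < 1 / C" "1 / C \<le> pi" using C pi_gt3 mult_mono[of 1 pi 1 C] by (auto simp: divide_le_eq)
  have "cos (arccos t) \<le> cos (1 / C)"
    using ang inv arccos_ubound[of t] t0 t1 unfolding triangle_angle_def n_def[symmetric] t_def[symmetric]
    by (intro cos_monotone_0_pi_le) auto
  then have "t \<le> cos (1 / C)" using t0 t1 by (simp add: cos_arccos)
  then have "t\<^sup>2 \<le> (cos (1 / C))\<^sup>2" using t0 by (simp add: power_mono)
  then have "(sin (1 / C))\<^sup>2 \<le> 1 - t\<^sup>2" using sin_cos_squared_add[of "1/C"] by linarith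
  also have "\<dots> \<le> n\<^sup>2 * (1 - t\<^sup>2)"
    using n t0 t1 mult_right_mono[of 1 "n\<^sup>2" "1 - t\<^sup>2"] by (simp add: abs_square_le_1 one_le_power)
  also have "\<dots> = (cross2 (a - b) (c - b))\<^sup>2"
    using n by (simp add: cross2_sq t_def n_def power_divide power_mult_distrib field_simps)
  finally have *: "(sin (1 / C))\<^sup>2 \<le> (cross2 (a - b) (c - b))\<^sup>2" .
  have "0 \<le> sin (1 / C)" using inv by (intro sin_ge_zero) auto
  then show ?thesis using * abs_le_square_iff[of "sin (1/C)"] by simp
qed

text \<open>At least one of the angles at \<open>a\<close> and \<open>b\<close> is at most a right angle, and the cross product, being
  twice the area, does not depend on the corner.\<close>

lemma fat_triangle_cross2:
  assumes C: "1 \<le> C" and ang: "1 / C \<le> triangle_angle a b c" "1 / C \<le> triangle_angle b a c"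
    and d: "1 \<le> dist a b" "1 \<le> dist b c" "1 \<le> dist a c"
  shows "sin (1 / C) \<le> \<bar>cross2 (b - a) (c - a)\<bar>"
proof (cases "0 \<le> (a - b) \<bullet> (c - b)")
  case True
  have "\<bar>cross2 (a - b) (c - b)\<bar> = \<bar>cross2 (b - a) (c - a)\<bar>"
    by (simp add: cross2_def algebra_simps)
  then show ?thesis using fat_triangle_cross2_acute[OF C ang(1) d(1,2) True] by simp
next
  case False
  have "(b - a) \<bullet> (c - a) = (b - a) \<bullet> (b - a) - (a - b) \<bullet> (c - b)"
    by (simp add: inner_diff_left inner_diff_right inner_commute)
  then have "0 \<le> (b - a) \<bullet> (c - a)" using False inner_ge_zero[of "b - a"] by linarith
  then show ?thesis using fat_triangle_cross2_acute[OF C ang(2)] d by (simp add: dist_commute)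
qed

lemma content_triangle_cross2:
  "measure lborel (convex hull {a, b, c}) = \<bar>cross2 (b - a) (c - a)\<bar> / 2"
  by (simp add: content_triangle cross2_def abs_minus_commute algebra_simps)

section \<open>Integrals of continuous functions\<close>

lemma continuous_set_integrable_bounded:
  fixes h :: "'a::euclidean_space \<Rightarrow> real"
  assumes "continuous_on UNIV h" "bounded S" "S \<in> sets borel"
  shows "set_integrable lborel S h"
proof -
  obtain a b where "S \<subseteq> cbox a b" using bounded_subset_cbox_symmetric[OF assms(2)] by blast
  moreover have "set_integrable lborel (cbox a b) h"
    unfolding set_integrable_def
    by (rule borel_integrable_compact) (auto intro: continuous_on_subset[OF assms(1)])
  ultimately show ?thesis using set_integrable_subset assms(3) by (metis sets_lborel)
qed

lemma set_integral_mono_set: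
  fixes h :: "'a::euclidean_space \<Rightarrow> real"
  assumes "continuous_on UNIV h" "\<And>x. 0 \<le> h x" "bounded T" "T \<in> sets borel" "S \<in> sets borel" "S \<subseteq> T"
  shows "(LINT x:S|lborel. h x) \<le> (LINT x:T|lborel. h x)"
proof -
  have "set_integrable lborel S h" "set_integrable lborel T h"
    using assms bounded_subset by (auto intro!: continuous_set_integrable_bounded)
  then show ?thesis
    unfolding set_lebesgue_integral_def set_integrable_def
    by (rule integral_mono) (use assms(2,6) in \<open>auto simp: indicator_def\<close>)
qed

lemma set_integral_nonneg_real:
  fixes h :: "'a::euclidean_space \<Rightarrow> real"
  assumes "\<And>x. 0 \<le> h x"
  shows "0 \<le> (LINT x:S|lborel. h x)"
  unfolding set_lebesgue_integral_def by (rule Bochner_Integration.integral_nonneg) (simp add: assms)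

lemma set_integral_ge_const:
  fixes h :: "'a::euclidean_space \<Rightarrow> real"
  assumes "continuous_on UNIV h" "bounded S" "S \<in> sets borel" "\<And>x. x \<in> S \<Longrightarrow> a \<le> h x"
  shows "measure lborel S * a \<le> (LINT x:S|lborel. h x)"
proof -
  have "(LINT x:S|lborel. a) \<le> (LINT x:S|lborel. h x)"
    by (rule set_integral_mono)
       (use assms continuous_set_integrable_bounded[of _ S] in auto)
  moreover have "(LINT x:S|lborel. a) = measure lborel S * a"
    using assms(2,3) emeasure_bounded_finite[OF assms(2)] by (simp add: set_integral_const less_top[symmetric])
  ultimately show ?thesis by simp
qed

lemma sum_set_integral_le_multiplicity:
  fixes h :: "'a::euclidean_space \<Rightarrow> real"
  assumes h: "continuous_on UNIV h" "\<And>x. 0 \<le> h x" and I: "finite I"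
    and S: "\<And>i. i \<in> I \<Longrightarrow> S i \<in> sets borel" "\<And>i. i \<in> I \<Longrightarrow> S i \<subseteq> B"
    and B: "bounded B" "B \<in> sets borel"
    and m: "\<And>x. real (card {i\<in>I. x \<in> S i}) \<le> m"
  shows "(\<Sum>i\<in>I. LINT x:S i|lborel. h x) \<le> m * (LINT x:B|lborel. h x)"
proof -
  have int: "set_integrable lborel (S i) h" if "i \<in> I" for i
    by (rule continuous_set_integrable_bounded[OF h(1) bounded_subset[OF B(1) S(2)[OF that]] S(1)[OF that]])
  have intB: "set_integrable lborel B h"
    by (rule continuous_set_integrable_bounded[OF h(1) B])
  have "(\<Sum>i\<in>I. LINT x:S i|lborel. h x) = (LINT x|lborel. (\<Sum>i\<in>I. indicator (S i) x *\<^sub>R h x))"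
    unfolding set_lebesgue_integral_def
    by (rule Bochner_Integration.integral_sum[symmetric]) (use int in \<open>simp add: set_integrable_def\<close>)
  also have "\<dots> \<le> (LINT x|lborel. m * (indicator B x *\<^sub>R h x))"
  proof (rule integral_mono)
    show "integrable lborel (\<lambda>x. \<Sum>i\<in>I. indicator (S i) x *\<^sub>R h x)"
      using int by (intro Bochner_Integration.integrable_sum) (simp add: set_integrable_def)
    show "integrable lborel (\<lambda>x. m * (indicator B x *\<^sub>R h x))"
      using intB by (intro integrable_mult_right) (simp add: set_integrable_def)
    fix x
    have "(\<Sum>i\<in>I. indicator (S i) x *\<^sub>R h x) = (\<Sum>i\<in>I. indicator (S i) x) * h x"
      by (simp add: sum_distrib_right)
    also have "(\<Sum>i\<in>I. indicator (S i) x) = real (card {i\<in>I. x \<in> S i})"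
      using I by (simp add: indicator_def sum.If_cases Int_def)
    also have "\<dots> * h x \<le> m * (indicator B x *\<^sub>R h x)"
    proof (cases "x \<in> B")
      case True
      then show ?thesis using m[of x] h(2)[of x] by (simp add: mult_right_mono)
    next
      case False
      then have no: "{i\<in>I. x \<in> S i} = {}" using S(2) by auto
      show ?thesis unfolding no using False by simp
    qed
    finally show "(\<Sum>i\<in>I. indicator (S i) x *\<^sub>R h x) \<le> m * (indicator B x *\<^sub>R h x)" .
  qed
  also have "\<dots> = m * (LINT x:B|lborel. h x)" by (simp add: set_lebesgue_integral_def)
  finally show ?thesis .
qed

lemma set_integral_homothety:
  fixes h :: "'a::euclidean_space \<Rightarrow> real" and v :: 'a
  assumes h: "h \<in> borel_measurable borel" and S: "S \<in> sets borel" and c: "0 < c"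
  shows "(LINT x:((\<lambda>x. v + c *\<^sub>R (x - v)) ` S)|lborel. h x)
    = c ^ DIM('a) * (LINT x:S|lborel. h (v + c *\<^sub>R (x - v)))"
proof -
  define t where "t = v - c *\<^sub>R v"
  define S' where "S' = (\<lambda>x. v + c *\<^sub>R (x - v)) ` S"
  have T: "v + c *\<^sub>R (x - v) = t + c *\<^sub>R x" for x by (simp add: t_def algebra_simps)
  have mem: "t + c *\<^sub>R x \<in> S' \<longleftrightarrow> x \<in> S" for x
    using c unfolding S'_def T by auto
  have "S' = (\<lambda>y. (1/c) *\<^sub>R (y - t)) -` S"
  proof (intro set_eqI)
    fix y
    have "y = t + c *\<^sub>R ((1/c) *\<^sub>R (y - t))" using c by simp
    then show "y \<in> S' \<longleftrightarrow> y \<in> (\<lambda>y. (1/c) *\<^sub>R (y - t)) -` S"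
      using mem[of "(1/c) *\<^sub>R (y - t)"] by simp
  qed
  moreover have "(\<lambda>y. (1/c) *\<^sub>R (y - t)) \<in> borel_measurable borel"
    by (intro borel_measurable_continuous_onI continuous_intros)
  ultimately have S': "S' \<in> sets borel"
    using S measurable_sets[of "\<lambda>y. (1/c) *\<^sub>R (y - t)" borel borel S] by simp
  have [measurable]: "(\<lambda>x. t + c *\<^sub>R x) \<in> borel_measurable borel"
    by (intro borel_measurable_continuous_onI continuous_intros)
  define k where "k = (\<lambda>x. indicator S' x *\<^sub>R h x)"
  have k: "k \<in> borel_measurable borel" unfolding k_def using h S' by measurable
  have "(LINT x|lborel. k x) = (LINT x|density (distr lborel borel (\<lambda>x. t + c *\<^sub>R x)) (\<lambda>_. \<bar>c\<bar>^DIM('a)). k x)"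
    using c by (subst lborel_affine[of c t]) auto
  also have "\<dots> = (LINT x|distr lborel borel (\<lambda>x. t + c *\<^sub>R x). c^DIM('a) *\<^sub>R k x)"
    using c k by (subst integral_density[symmetric]) (auto simp: ennreal_power)
  also have "\<dots> = (LINT x|lborel. c^DIM('a) *\<^sub>R k (t + c *\<^sub>R x))"
    using k by (subst integral_distr) auto
  finally show ?thesis
    unfolding S'_def[symmetric] unfolding T set_lebesgue_integral_def k_def
    by (simp add: indicator_def mem)
qed

text \<open>An affine function is determined at \<open>v\<close> by its values at \<open>x\<close> and at the midpoint \<open>m\<close> of \<open>v\<close> and \<open>x\<close>:
\<open>g v = 2 g m - g x\<close>.  When averaging over \<open>x\<close>, the midpoints fill the half-size copy of
\<open>S\<close> at \<open>v\<close>, which lies in \<open>S\<close> and has a quarter of its area; so \<open>34 = 8 * 4 + 2\<close>.\<close>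

lemma affine_sq_le_mean_over_triangle:
  fixes g :: "real^2 \<Rightarrow> real"
  assumes g: "continuous_on UNIV g" and K: "convex S" "compact S" "v \<in> S"
    and aff: "\<And>x. x \<in> S \<Longrightarrow> g x = \<alpha> \<bullet> x + \<beta>"
  shows "measure lborel S * (g v)\<^sup>2 \<le> 34 * (LINT x:S|lborel. (g x)\<^sup>2)"
proof -
  define h where "h = (\<lambda>x. (g x)\<^sup>2)"
  define m where "m = (\<lambda>x. v + (1/2) *\<^sub>R (x - v))"
  have hc: "continuous_on UNIV h" unfolding h_def by (intro continuous_intros g)
  have hm: "h \<in> borel_measurable borel" using hc by (rule borel_measurable_continuous_onI)
  have mc: "continuous_on UNIV m" unfolding m_def by (intro continuous_intros)
  have mS: "m ` S \<subseteq> S"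
  proof
    fix y assume "y \<in> m ` S"
    then obtain x where x: "x \<in> S" "y = m x" by auto
    have "v + c *\<^sub>R (x - v) = (1 - c) *\<^sub>R v + c *\<^sub>R x" for c by (simp add: algebra_simps)
    then have "y = (1 - 1/2) *\<^sub>R v + (1/2) *\<^sub>R x" unfolding x(2) m_def .
    then show "y \<in> S" using convexD[OF K(1) K(3) x(1), of "1 - 1/2" "1/2"] by simp
  qed
  have Sb: "S \<in> sets borel" "bounded S" using K(2) by (auto simp: borel_compact compact_imp_bounded)
  have hmc: "continuous_on UNIV (\<lambda>x. h (m x))"
    by (rule continuous_on_compose2[OF hc mc]) auto
  have comp: "compact (m ` S)" using K(2) mc by (meson compact_continuous_image continuous_on_subset subset_UNIV)
  have scal: "(LINT x:S|lborel. h (m x)) = 4 * (LINT x:m ` S|lborel. h x)"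
    using set_integral_homothety[OF hm Sb(1), of "1/2" v] by (simp add: m_def power2_eq_square)
  have "(LINT x:m ` S|lborel. h x) \<le> (LINT x:S|lborel. h x)"
    by (rule set_integral_mono_set[OF hc]) (use Sb mS comp in \<open>auto simp: h_def borel_compact\<close>)
  then have 1: "(LINT x:S|lborel. h (m x)) \<le> 4 * (LINT x:S|lborel. h x)" using scal by simp
  have ptw: "(g v)\<^sup>2 \<le> 8 * h (m x) + 2 * h x" if "x \<in> S" for x
  proof -
    have "g v = 2 * g (m x) - g x"
      using aff[OF K(3)] aff[OF that] aff[of "m x"] mS that
      by (auto simp: m_def inner_add_right inner_diff_right field_simps)
    moreover have "(2 * s - t)\<^sup>2 \<le> 8 * s\<^sup>2 + 2 * t\<^sup>2" for s t :: real
      using zero_le_power2[of "2 * s + t"] by (simp add: power2_eq_square algebra_simps)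
    ultimately show ?thesis by (simp add: h_def)
  qed
  have i1: "set_integrable lborel S (\<lambda>x. h (m x))" "set_integrable lborel S h"
    using continuous_set_integrable_bounded Sb hc hmc by blast+
  have "measure lborel S * (g v)\<^sup>2 \<le> (LINT x:S|lborel. 8 * h (m x) + 2 * h x)"
    by (rule set_integral_ge_const) (use Sb hc hmc ptw in \<open>auto intro!: continuous_intros\<close>)
  also have "\<dots> = 8 * (LINT x:S|lborel. h (m x)) + 2 * (LINT x:S|lborel. h x)"
    using i1 by (subst set_integral_add) auto
  also have "\<dots> \<le> 34 * (LINT x:S|lborel. h x)" using 1 by linarith
  finally show ?thesis by (simp add: h_def)
qed

section \<open>The Caccioppoli inequality on a graph\<close>

text \<open>Harmonicity tested against \<open>\<phi>\<^sup>2 f\<close> gives \<open>\<Sum> ((\<phi> x)\<^sup>2 f x - (\<phi> y)\<^sup>2 f y) (f x - f y) = 0\<close>.  The summand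
differs from the weighted energy density by a product that contains the factor \<open>\<phi> x - \<phi> y\<close>, and this
product is absorbed by completing a square.\<close>

lemma caccioppoli:
  fixes E :: "'a \<Rightarrow> 'a \<Rightarrow> bool" and f \<phi> :: "'a \<Rightarrow> real"
  assumes fin: "finite W" and sym: "\<And>x y. E x y \<Longrightarrow> E y x"
    and harm: "\<And>x. x \<in> W \<Longrightarrow> \<phi> x \<noteq> 0 \<Longrightarrow> (\<Sum>y | E x y. f y - f x) = 0"
    and nbrs: "\<And>x. x \<in> W \<Longrightarrow> \<phi> x \<noteq> 0 \<Longrightarrow> {y. E x y} \<subseteq> W"
  defines "P \<equiv> {(x, y). x \<in> W \<and> y \<in> W \<and> E x y}"
  shows "(\<Sum>(x,y)\<in>P. ((\<phi> x)\<^sup>2 + (\<phi> y)\<^sup>2) / 2 * (f x - f y)\<^sup>2)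
    \<le> (\<Sum>(x,y)\<in>P. (\<phi> x - \<phi> y)\<^sup>2 * (f x + f y)\<^sup>2)"
proof -
  have Psig: "P = Sigma W (\<lambda>x. {y\<in>W. E x y})" by (auto simp: P_def)
  have finP: "finite P" unfolding Psig using fin by auto
  have 0: "(\<Sum>(x,y)\<in>P. (\<phi> x)\<^sup>2 * f x * (f x - f y)) = 0"
  proof -
    have "(\<Sum>(x,y)\<in>P. (\<phi> x)\<^sup>2 * f x * (f x - f y))
        = (\<Sum>x\<in>W. \<Sum>y\<in>{y\<in>W. E x y}. (\<phi> x)\<^sup>2 * f x * (f x - f y))"
      unfolding Psig using fin by (subst sum.Sigma) auto
    also have "\<dots> = 0"
    proof (rule sum.neutral, rule ballI)
      fix x assume x: "x \<in> W"
      show "(\<Sum>y\<in>{y\<in>W. E x y}. (\<phi> x)\<^sup>2 * f x * (f x - f y)) = 0"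
      proof (cases "\<phi> x = 0")
        case False
        then have "{y\<in>W. E x y} = {y. E x y}" using nbrs[OF x] by auto
        moreover have "(\<Sum>y | E x y. f x - f y) = - (\<Sum>y | E x y. f y - f x)"
          by (simp add: sum_negf[symmetric])
        ultimately show ?thesis using harm[OF x False] by (simp add: sum_distrib_left[symmetric])
      qed simp
    qed
    finally show ?thesis .
  qed
  have swap: "(\<Sum>(x,y)\<in>P. (\<phi> y)\<^sup>2 * f y * (f y - f x)) = (\<Sum>(x,y)\<in>P. (\<phi> x)\<^sup>2 * f x * (f x - f y))"
    by (rule sum.reindex_bij_witness[of _ prod.swap prod.swap]) (auto simp: P_def sym)
  have "(\<Sum>(x,y)\<in>P. ((\<phi> x)\<^sup>2 + (\<phi> y)\<^sup>2) / 2 * (f x - f y)\<^sup>2)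
     \<le> (\<Sum>(x,y)\<in>P. 2 * ((\<phi> x)\<^sup>2 * f x * (f x - f y)) + 2 * ((\<phi> y)\<^sup>2 * f y * (f y - f x))
           + (\<phi> x - \<phi> y)\<^sup>2 * (f x + f y)\<^sup>2)"
  proof (rule sum_mono, clarify)
    fix x y
    define s t a b where "s = \<phi> x" and "t = \<phi> y" and "a = f x" and "b = f y"
    \<comment> \<open>The difference of the two sides is this sum of squares.\<close>
    have "0 \<le> ((s - t) * (a + b) + (s + t) * (a - b) / 2)\<^sup>2 + ((s - t) * (a - b))\<^sup>2 / 4" by simp
    also have "\<dots> = 2 * (s\<^sup>2 * a * (a - b)) + 2 * (t\<^sup>2 * b * (b - a)) + (s - t)\<^sup>2 * (a + b)\<^sup>2
        - (s\<^sup>2 + t\<^sup>2) / 2 * (a - b)\<^sup>2"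
      by (simp add: power2_eq_square field_simps)
    finally show "((\<phi> x)\<^sup>2 + (\<phi> y)\<^sup>2) / 2 * (f x - f y)\<^sup>2 \<le>
      2 * ((\<phi> x)\<^sup>2 * f x * (f x - f y)) + 2 * ((\<phi> y)\<^sup>2 * f y * (f y - f x)) + (\<phi> x - \<phi> y)\<^sup>2 * (f x + f y)\<^sup>2"
      by (simp add: s_def t_def a_def b_def)
  qed
  also have "\<dots> = 2 * (\<Sum>(x,y)\<in>P. (\<phi> x)\<^sup>2 * f x * (f x - f y))
      + 2 * (\<Sum>(x,y)\<in>P. (\<phi> y)\<^sup>2 * f y * (f y - f x)) + (\<Sum>(x,y)\<in>P. (\<phi> x - \<phi> y)\<^sup>2 * (f x + f y)\<^sup>2)"
    by (simp add: case_prod_unfold sum.distrib sum_distrib_left)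
  also have "\<dots> = (\<Sum>(x,y)\<in>P. (\<phi> x - \<phi> y)\<^sup>2 * (f x + f y)\<^sup>2)" using 0 swap by simp
  finally show ?thesis .
qed

lemma cutoff_lipschitz:
  fixes s t M :: real
  assumes "0 < M" "\<bar>s - t\<bar> \<le> 1"
  shows "(max 0 (min 1 (2 - s / M)) - max 0 (min 1 (2 - t / M)))\<^sup>2 \<le> 1 / M\<^sup>2"
proof -
  have "\<bar>max 0 (min 1 (2 - s / M)) - max 0 (min 1 (2 - t / M))\<bar> \<le> \<bar>s / M - t / M\<bar>" by linarith
  also have "\<dots> = \<bar>s - t\<bar> / M" using assms(1) by (simp add: diff_divide_distrib[symmetric])
  also have "\<dots> \<le> 1 / M" using assms by (simp add: divide_right_mono)
  finally have "\<bar>max 0 (min 1 (2 - s / M)) - max 0 (min 1 (2 - t / M))\<bar>\<^sup>2 \<le> (1 / M)\<^sup>2"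
    by (intro power_mono) auto
  then show ?thesis by (simp add: power_divide)
qed

section \<open>Oscillation along the boundary of a square\<close>

lemma chain_oscillation:
  fixes g :: "'a \<Rightarrow> real"
  assumes osc: "\<And>k x y. k < n \<Longrightarrow> x \<in> A k \<Longrightarrow> y \<in> A k \<Longrightarrow> \<bar>g x - g y\<bar> \<le> \<omega> k"
    and meet: "\<And>k. Suc k < n \<Longrightarrow> A k \<inter> A (Suc k) \<noteq> {}"
    and ij: "i \<le> j" "j < n" "x \<in> A i" "y \<in> A j"
  shows "\<bar>g x - g y\<bar> \<le> (\<Sum>k=i..j. \<omega> k)"
  using ij(1,2,4)
proof (induction j arbitrary: y rule: dec_induct)
  case base
  then show ?case using osc ij(3) by simp
next
  case (step j)
  obtain q where q: "q \<in> A j" "q \<in> A (Suc j)" using meet step.prems(1) by blast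
  have "\<bar>g x - g q\<bar> \<le> (\<Sum>k=i..j. \<omega> k)" using step q by simp
  moreover have "\<bar>g q - g y\<bar> \<le> \<omega> (Suc j)" using osc step.prems q by blast
  ultimately show ?case using step.hyps by (simp add: sum.atLeast_Suc_atMost) 
qed

text \<open>The value at a point of a chain is compared with the values in every link, and the result is averaged over
the links.  The numbers \<open>I k\<close> stand for the means of \<open>g\<^sup>2\<close> over the links.\<close>

lemma chain_sq_bound:
  fixes g :: "'a \<Rightarrow> real"
  assumes osc: "\<And>k x y. k < n \<Longrightarrow> x \<in> A k \<Longrightarrow> y \<in> A k \<Longrightarrow> \<bar>g x - g y\<bar> \<le> \<omega> k"
    and ne: "\<And>k. k < n \<Longrightarrow> A k \<noteq> {}"
    and meet: "\<And>k. Suc k < n \<Longrightarrow> A k \<inter> A (Suc k) \<noteq> {}"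
    and avg: "\<And>k a. k < n \<Longrightarrow> (\<And>y. y \<in> A k \<Longrightarrow> a \<le> (g y)\<^sup>2) \<Longrightarrow> a \<le> I k"
    and i: "i < n" "x \<in> A i"
  shows "(g x)\<^sup>2 \<le> (\<Sum>k<n. 2 / real n * I k + 2 * real n * (\<omega> k)\<^sup>2)"
proof -
  have w0: "0 \<le> \<omega> k" if "k < n" for k
    using osc[OF that] ne[OF that] by (metis abs_ge_zero ex_in_conv order_trans)
  have far: "\<bar>g x - g y\<bar> \<le> (\<Sum>k<n. \<omega> k)" if "j < n" "y \<in> A j" for j y
  proof -
    have "\<bar>g x - g y\<bar> \<le> (\<Sum>k=min i j..max i j. \<omega> k)"
    proof (cases "i \<le> j")
      case True
      then show ?thesis using chain_oscillation[where A=A and n=n and \<omega>=\<omega> and g=g, OF osc meet _ that(1) i(2) that(2)]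
        by (simp add: min_def max_def)
    next
      case False
      then show ?thesis using chain_oscillation[where A=A and n=n and \<omega>=\<omega> and g=g, OF osc meet _ i(1) that(2) i(2)]
        by (simp add: min_def max_def abs_minus_commute)
    qed
    also have "\<dots> \<le> (\<Sum>k<n. \<omega> k)"
      by (rule sum_mono2) (use that i w0 in auto)
    finally show ?thesis .
  qed
  define B where "B = real n * (\<Sum>k<n. (\<omega> k)\<^sup>2)"
  have cs: "(\<Sum>k<n. \<omega> k)\<^sup>2 \<le> B"
    using sum_squared_le_sum_of_squares[of \<omega> "{..<n}"] by (simp add: B_def mult.commute)
  have "((g x)\<^sup>2 - 2 * B) / 2 \<le> I j" if j: "j < n" for j
  proof (rule avg[OF j])
    fix y assume y: "y \<in> A j"
    have "(g x - g y)\<^sup>2 \<le> (\<Sum>k<n. \<omega> k)\<^sup>2"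
      using far[OF j y] by (metis abs_ge_zero power2_abs power_mono)
    then have "(g x - g y)\<^sup>2 \<le> B" using cs by linarith
    moreover have "(g x)\<^sup>2 \<le> 2 * (g y)\<^sup>2 + 2 * (g x - g y)\<^sup>2"
      using zero_le_power2[of "g x - 2 * g y"] by (simp add: power2_eq_square algebra_simps)
    ultimately show "((g x)\<^sup>2 - 2 * B) / 2 \<le> (g y)\<^sup>2" by simp
  qed
  then have "(\<Sum>j<n. ((g x)\<^sup>2 - 2 * B) / 2) \<le> (\<Sum>j<n. I j)" by (intro sum_mono) auto
  then have "(g x)\<^sup>2 \<le> 2 / real n * (\<Sum>j<n. I j) + 2 * B" using i(1) by (simp add: field_simps)
  then show ?thesis by (simp add: B_def sum.distrib sum_distrib_left mult.assoc)
qed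

definition lattice_point :: "real^2 \<Rightarrow> int \<times> int \<Rightarrow> real^2" where
  "lattice_point p q = p + vector [of_int (fst q), of_int (snd q)]"

definition lattice_cell :: "real^2 \<Rightarrow> int \<times> int \<Rightarrow> (real^2) set" where
  "lattice_cell p q = cbox (lattice_point p q) (lattice_point p (fst q + 1, snd q + 1))"

lemma mem_lattice_cell:
  "x \<in> lattice_cell p q \<longleftrightarrow>
     of_int (fst q) \<le> x$1 - p$1 \<and> x$1 - p$1 \<le> of_int (fst q) + 1 \<and>
     of_int (snd q) \<le> x$2 - p$2 \<and> x$2 - p$2 \<le> of_int (snd q) + 1"
  by (auto simp: lattice_cell_def lattice_point_def mem_box_cart forall_2)

lemma lattice_point_nth [simp]:
  "lattice_point p q $ 1 = p$1 + of_int (fst q)" "lattice_point p q $ 2 = p$2 + of_int (snd q)"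
  by (simp_all add: lattice_point_def)

lemma measure_lattice_cell: "measure lborel (lattice_cell p q) = 1"
proof -
  have "cbox (lattice_point p q) (lattice_point p (fst q + 1, snd q + 1)) \<noteq> {}"
    by (subst interval_ne_empty_cart) (simp add: forall_2)
  then show ?thesis unfolding lattice_cell_def
    by (subst content_cbox_cart) (auto simp: UNIV_2)
qed

lemma lattice_cell_props:
  "compact (lattice_cell p q)" "convex (lattice_cell p q)" "lattice_cell p q \<in> sets borel"
  "bounded (lattice_cell p q)" "lattice_point p q \<in> lattice_cell p q"
  by (auto simp: lattice_cell_def compact_cbox convex_box bounded_cbox)
     (simp add: mem_box_cart forall_2)

lemma norm_le_2_components: "norm (x::real^2) \<le> \<bar>x$1\<bar> + \<bar>x$2\<bar>"
  using norm_le_l1_cart[of x] by (simp add: sum_2)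

lemma lattice_cell_dist: "x \<in> lattice_cell p q \<Longrightarrow> y \<in> lattice_cell p q \<Longrightarrow> dist x y \<le> 2"
  using norm_le_2_components[of "x - y"] by (auto simp: mem_lattice_cell dist_norm)

definition lattice_box :: "nat \<Rightarrow> (int \<times> int) set" where
  "lattice_box n = {q. \<bar>fst q\<bar> \<le> int n \<and> \<bar>snd q\<bar> \<le> int n}"

lemma finite_lattice_box: "finite (lattice_box n)"
proof -
  have "lattice_box n \<subseteq> {- int n..int n} \<times> {- int n..int n}" by (auto simp: lattice_box_def)
  then show ?thesis by (rule finite_subset) simp
qed

lemma lattice_point_dist: "dist p (lattice_point p q) \<le> \<bar>of_int (fst q)\<bar> + \<bar>of_int (snd q)\<bar>"
  using norm_le_2_components[of "lattice_point p q - p"] by (simp add: dist_norm norm_minus_commute)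

lemma lattice_box_point_dist: "q \<in> lattice_box n \<Longrightarrow> dist p (lattice_point p q) \<le> 2 * real n"
  using lattice_point_dist[of p q] unfolding lattice_box_def mem_Collect_eq by linarith

definition square_boundary :: "real^2 \<Rightarrow> nat \<Rightarrow> (real^2) set" where
  "square_boundary p r = {z. \<bar>z$1 - p$1\<bar> \<le> real r \<and> \<bar>z$2 - p$2\<bar> \<le> real r \<and>
     (\<bar>z$1 - p$1\<bar> = real r \<or> \<bar>z$2 - p$2\<bar> = real r)}"

text \<open>Each side of the square of half side \<open>r\<close> is covered by a row or a column of \<open>2 r + 1\<close> lattice cells whose indices
have maximum norm \<open>r\<close>.  These rings of indices are disjoint for different \<open>r\<close>, so the costs \<open>H\<close> of the
\<open>N\<close> rings with \<open>N \<le> r < 2 N\<close> add up to at most the cost of the whole box, and the cheapest ring costs at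
most \<open>1/N\<close> of it.\<close>

lemma good_square:
  fixes g :: "real^2 \<Rightarrow> real"
  assumes N: "1 \<le> N"
    and osc: "\<And>q x y. q \<in> lattice_box (2 * N) \<Longrightarrow> x \<in> lattice_cell p q \<Longrightarrow> y \<in> lattice_cell p q \<Longrightarrow> \<bar>g x - g y\<bar> \<le> \<omega> q"
    and avg: "\<And>q a. q \<in> lattice_box (2 * N) \<Longrightarrow> (\<And>y. y \<in> lattice_cell p q \<Longrightarrow> a \<le> (g y)\<^sup>2) \<Longrightarrow> a \<le> I q"
    and I0: "\<And>q. 0 \<le> I q"
  obtains r where "N \<le> r" "r < 2 * N"
    "\<And>z. z \<in> square_boundary p r \<Longrightarrow>
       (g z)\<^sup>2 \<le> (\<Sum>q\<in>lattice_box (2 * N). I q) / (real N)\<^sup>2 + 8 * (\<Sum>q\<in>lattice_box (2 * N). (\<omega> q)\<^sup>2)"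
proof -
  \<comment> \<open>The cost of a cell, such that the bound for a chain of \<open>2 r + 1\<close> cells is at most their total cost.\<close>
  define H where "H q = I q / real N + 8 * real N * (\<omega> q)\<^sup>2" for q
  have H0: "0 \<le> H q" for q using I0 by (simp add: H_def)
  define ring where "ring r = {q::int\<times>int. max \<bar>fst q\<bar> \<bar>snd q\<bar> = int r}" for r
  have ring_sub: "ring r \<subseteq> lattice_box (2 * N)" if "r < 2 * N" for r
    using that by (auto simp: ring_def lattice_box_def)
  have fin_ring: "finite (ring r)" if "r < 2 * N" for r
    using finite_subset[OF ring_sub[OF that] finite_lattice_box] .
  have bound: "(g z)\<^sup>2 \<le> (\<Sum>q\<in>ring r. H q)" if r: "N \<le> r" "r < 2 * N" and z: "z \<in> square_boundary p r" for r z
  proof -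
    define n where "n = 2 * r + 1"
    have side: "(g z)\<^sup>2 \<le> (\<Sum>q\<in>ring r. H q)"
      if e: "\<And>k. k < n \<Longrightarrow> e k \<in> ring r" "inj_on e {..<n}"
        and meet: "\<And>k. Suc k < n \<Longrightarrow> lattice_cell p (e k) \<inter> lattice_cell p (e (Suc k)) \<noteq> {}"
        and i: "i < n" "z \<in> lattice_cell p (e i)" for e :: "nat \<Rightarrow> int \<times> int" and i
    proof -
      have eb: "e k \<in> lattice_box (2 * N)" if "k < n" for k using e(1)[OF that] ring_sub[OF r(2)] by blast
      have "(g z)\<^sup>2 \<le> (\<Sum>k<n. 2 / real n * I (e k) + 2 * real n * (\<omega> (e k))\<^sup>2)"
        by (rule chain_sq_bound[where A = "\<lambda>k. lattice_cell p (e k)" and g = g and \<omega> = "\<lambda>k. \<omega> (e k)" and i=i])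
           (use osc avg eb meet i lattice_cell_props(5) in blast)+
      also have "\<dots> \<le> (\<Sum>k<n. H (e k))"
      proof (rule sum_mono)
        fix k
        have "2 / real n \<le> 1 / real N" using r N by (simp add: n_def field_simps)
        then have "2 / real n * I (e k) \<le> 1 / real N * I (e k)" using I0 by (rule mult_right_mono)
        moreover have "2 * real n * (\<omega> (e k))\<^sup>2 \<le> 8 * real N * (\<omega> (e k))\<^sup>2"
          using r by (intro mult_right_mono) (auto simp: n_def)
        ultimately show "2 / real n * I (e k) + 2 * real n * (\<omega> (e k))\<^sup>2 \<le> H (e k)" by (simp add: H_def)
      qed
      also have "\<dots> = (\<Sum>q\<in>e ` {..<n}. H q)" using e(2) by (simp add: sum.reindex)
      also have "\<dots> \<le> (\<Sum>q\<in>ring r. H q)"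
        using e(1) H0 fin_ring[OF r(2)] by (intro sum_mono2) auto
      finally show ?thesis .
    qed
    from z consider (vert) s :: int where "\<bar>s\<bar> = 1" "z$1 - p$1 = of_int s * real r" "\<bar>z$2 - p$2\<bar> \<le> real r"
      | (horiz) s :: int where "\<bar>s\<bar> = 1" "z$2 - p$2 = of_int s * real r" "\<bar>z$1 - p$1\<bar> \<le> real r"
    proof -
      have sgn: "\<exists>s::int. \<bar>s\<bar> = 1 \<and> t = of_int s * real r" if "\<bar>t\<bar> = real r" for t :: real
      proof (cases "0 \<le> t")
        case True
        then show ?thesis using that by (intro exI[of _ 1]) auto
      next
        case False
        then show ?thesis using that by (intro exI[of _ "-1"]) auto
      qed
      show thesis using z sgn that unfolding square_boundary_def by blast
    qed
    then show ?thesis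
    proof cases
      case vert
      define e where "e k = (s * int r, int k - int r)" for k :: nat
      define i where "i = nat (\<lfloor>z$2 - p$2\<rfloor> + int r)"
      have fl: "- int r \<le> \<lfloor>z$2 - p$2\<rfloor>" "\<lfloor>z$2 - p$2\<rfloor> \<le> int r" using vert(3) by linarith+
      show ?thesis
      proof (rule side[of e i])
        show "e k \<in> ring r" if "k < n" for k
          using that vert(1) by (auto simp: e_def ring_def n_def abs_mult max_def)
        show "inj_on e {..<n}" by (auto simp: inj_on_def e_def)
        show "lattice_cell p (e k) \<inter> lattice_cell p (e (Suc k)) \<noteq> {}" for k
        proof -
          have "lattice_point p (e (Suc k)) \<in> lattice_cell p (e k) \<inter> lattice_cell p (e (Suc k))"
            by (simp add: mem_lattice_cell e_def)
          then show ?thesis by blast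
        qed
        show "i < n" using fl by (simp add: i_def n_def)
        have "int i = \<lfloor>z$2 - p$2\<rfloor> + int r" using fl by (simp add: i_def)
        then have "e i = (s * int r, \<lfloor>z$2 - p$2\<rfloor>)" by (simp add: e_def)
        then show "z \<in> lattice_cell p (e i)"
          using vert(2) by (simp add: mem_lattice_cell)
      qed
    next
      case horiz
      define e where "e k = (int k - int r, s * int r)" for k :: nat
      define i where "i = nat (\<lfloor>z$1 - p$1\<rfloor> + int r)"
      have fl: "- int r \<le> \<lfloor>z$1 - p$1\<rfloor>" "\<lfloor>z$1 - p$1\<rfloor> \<le> int r" using horiz(3) by linarith+
      show ?thesis
      proof (rule side[of e i])
        show "e k \<in> ring r" if "k < n" for k
          using that horiz(1) by (auto simp: e_def ring_def n_def abs_mult max_def)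
        show "inj_on e {..<n}" by (auto simp: inj_on_def e_def)
        show "lattice_cell p (e k) \<inter> lattice_cell p (e (Suc k)) \<noteq> {}" for k
        proof -
          have "lattice_point p (e (Suc k)) \<in> lattice_cell p (e k) \<inter> lattice_cell p (e (Suc k))"
            by (simp add: mem_lattice_cell e_def)
          then show ?thesis by blast
        qed
        show "i < n" using fl by (simp add: i_def n_def)
        have "int i = \<lfloor>z$1 - p$1\<rfloor> + int r" using fl by (simp add: i_def)
        then have "e i = (\<lfloor>z$1 - p$1\<rfloor>, s * int r)" by (simp add: e_def)
        then show "z \<in> lattice_cell p (e i)"
          using horiz(2) by (simp add: mem_lattice_cell)
      qed
    qed
  qed
  have "(\<Sum>r\<in>{N..<2*N}. \<Sum>q\<in>ring r. H q) = (\<Sum>q\<in>(\<Union>r\<in>{N..<2*N}. ring r). H q)"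
    by (rule sum.UNION_disjoint[symmetric]) (use fin_ring in \<open>auto simp: ring_def\<close>)
  also have "\<dots> \<le> (\<Sum>q\<in>lattice_box (2 * N). H q)"
  proof (rule sum_mono2[OF finite_lattice_box])
    show "(\<Union>r\<in>{N..<2*N}. ring r) \<subseteq> lattice_box (2 * N)" using ring_sub by (intro UN_least) simp
  qed (rule H0)
  finally have tot: "(\<Sum>r\<in>{N..<2*N}. \<Sum>q\<in>ring r. H q) \<le> (\<Sum>q\<in>lattice_box (2 * N). H q)" .
  have "\<exists>r\<in>{N..<2*N}. (\<Sum>q\<in>ring r. H q) \<le> (\<Sum>q\<in>lattice_box (2 * N). H q) / real N"
  proof (rule ccontr)
    assume no: "\<not> ?thesis"
    have "(\<Sum>q\<in>lattice_box (2 * N). H q) / real N < (\<Sum>q\<in>ring r. H q)" if "r \<in> {N..<2*N}" for r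
      using no that by (meson not_le)
    then have "(\<Sum>r\<in>{N..<2*N}. (\<Sum>q\<in>lattice_box (2 * N). H q) / real N) < (\<Sum>r\<in>{N..<2*N}. \<Sum>q\<in>ring r. H q)"
      using N by (intro sum_strict_mono) (simp_all, linarith?)
    then show False using tot N by simp
  qed
  then obtain r where r: "N \<le> r" "r < 2 * N" "(\<Sum>q\<in>ring r. H q) \<le> (\<Sum>q\<in>lattice_box (2 * N). H q) / real N"
    by auto
  have "(\<Sum>q\<in>lattice_box (2 * N). H q) / real N
      = (\<Sum>q\<in>lattice_box (2 * N). I q) / (real N)\<^sup>2 + 8 * (\<Sum>q\<in>lattice_box (2 * N). (\<omega> q)\<^sup>2)"
    using N by (simp add: H_def sum.distrib sum_divide_distrib[symmetric] sum_distrib_left[symmetric]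
        add_divide_distrib power2_eq_square)
  then show thesis using that[OF r(1,2)] bound[OF r(1,2)] r(3) by fastforce
qed

section \<open>The embedded penny graph\<close>

lemma penny_config_separated:
  assumes "infinite_penny_config V"
  shows "unit_separated V"
  unfolding unit_separated_def
proof (intro ballI impI, rule ccontr)
  fix u v assume uv: "u \<in> V" "v \<in> V" "u \<noteq> v" "\<not> 1 \<le> dist u v"
  then have "disjnt (ball u (1/2)) (ball v (1/2))"
    using assms by (auto simp: infinite_penny_config_def pairwise_def)
  moreover have "midpoint u v \<in> ball u (1/2) \<inter> ball v (1/2)"
    using uv(4) by (simp add: dist_midpoint)
  ultimately show False by (auto simp: disjnt_def)
qed

lemma penny_adj_sym: "penny_adj V u v \<Longrightarrow> penny_adj V v u"
  by (auto simp: penny_adj_def Int_commute)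

lemma penny_adj_in: "penny_adj V u v \<Longrightarrow> u \<in> V" "penny_adj V u v \<Longrightarrow> v \<in> V"
  by (auto simp: penny_adj_def)

lemma penny_adj_dist:
  assumes "unit_separated V" "penny_adj V u v"
  shows "dist u v = 1"
proof -
  obtain q where "q \<in> sphere u (1/2) \<inter> sphere v (1/2)"
    using assms(2) unfolding penny_adj_def is_singleton_def by blast
  then have "dist u v \<le> 1" using dist_triangle[of u v q] by (simp add: dist_commute)
  then show ?thesis using assms by (force simp: unit_separated_def penny_adj_def)
qed

lemma edge_no_inner_vertex:
  assumes "unit_separated V" "penny_adj V x y" "z \<in> open_segment x y"
  shows "z \<notin> V"
proof
  assume "z \<in> V"
  have "dist z x < 1" using dist_in_open_segment[OF assms(3)] penny_adj_dist[OF assms(1,2)] by simp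
  then have "z = x" using assms(1) \<open>z \<in> V\<close> penny_adj_in[OF assms(2)] by (force simp: unit_separated_def)
  then show False using assms(3) by (simp add: open_segment_def)
qed

lemma edge_subset_skeleton: "penny_adj V x y \<Longrightarrow> closed_segment x y \<subseteq> penny_skeleton V"
  by (auto simp: penny_skeleton_def)

text \<open>Locally the embedded graph is a finite union of points and unit segments.\<close>

lemma closed_penny_skeleton:
  assumes sep: "unit_separated V"
  shows "closed (penny_skeleton V)"
proof -
  have "\<exists>e>0. ball x e \<subseteq> - penny_skeleton V" if x: "x \<in> - penny_skeleton V" for x
  proof -
    define F where "F = V \<inter> cball x 2"
    have F: "finite F" unfolding F_def by (rule unit_separated_packing[OF sep]) simp
    define G where "G = F \<union> (\<Union>e\<in>{e\<in>F\<times>F. penny_adj V (fst e) (snd e)}. closed_segment (fst e) (snd e))"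
    have "closed G" unfolding G_def using F by (intro closed_Un finite_imp_closed closed_UN) auto
    moreover have "x \<notin> G"
      using x edge_subset_skeleton unfolding G_def F_def penny_skeleton_def by fastforce
    ultimately obtain e where e: "e > 0" "ball x e \<subseteq> - G"
      by (meson ComplI open_Compl open_contains_ball)
    have "y \<notin> penny_skeleton V" if y: "y \<in> ball x (min e 1)" for y
    proof
      assume "y \<in> penny_skeleton V"
      then consider "y \<in> V" | u v where "penny_adj V u v" "y \<in> closed_segment u v"
        by (auto simp: penny_skeleton_def)
      then have "y \<in> G"
      proof cases
        case 1
        then show ?thesis using y by (auto simp: G_def F_def)
      next
        case 2
        have "dist u y \<le> 1" "dist v y \<le> 1"
          using dist_in_closed_segment[OF 2(2)] penny_adj_dist[OF sep 2(1)] by (auto simp: dist_commute)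
        then have "dist x u \<le> 2" "dist x v \<le> 2"
          using y dist_triangle[of x u y] dist_triangle[of x v y] by (auto simp: dist_commute)
        then have "(u, v) \<in> {e\<in>F\<times>F. penny_adj V (fst e) (snd e)}"
          using 2(1) penny_adj_in[OF 2(1)] by (auto simp: F_def)
        then show ?thesis unfolding G_def using 2(2) by force
      qed
      then show False using e(2) y by auto
    qed
    then show ?thesis using e(1) by (intro exI[of _ "min e 1"]) auto
  qed
  then have "open (- penny_skeleton V)" unfolding open_contains_ball by blast
  then show ?thesis by (simp add: closed_def)
qed

lemma connected_penny_skeleton:
  assumes "penny_connected V" "V \<noteq> {}"
  shows "connected (penny_skeleton V)"
proof -
  let ?S = "penny_skeleton V"
  have seg: "path_component ?S x y" if "penny_adj V u v" "x \<in> closed_segment u v" "y \<in> closed_segment u v" for u v x y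
  proof (rule path_component_of_subset)
    show "closed_segment u v \<subseteq> ?S" using edge_subset_skeleton that(1) .
    show "path_component (closed_segment u v) x y"
      using that convex_imp_path_connected[OF convex_closed_segment, of u v]
      by (simp add: path_connected_component)
  qed
  have vv: "path_component ?S u v" if "(penny_adj V)\<^sup>*\<^sup>* u v" "u \<in> V" for u v
    using that
  proof (induction rule: rtranclp_induct)
    case base
    then show ?case by (simp add: path_component_refl_eq penny_skeleton_def)
  next
    case (step y z)
    then show ?case using seg[of y z y z] by (meson ends_in_segment path_component_trans)
  qed
  obtain v0 where v0: "v0 \<in> V" using assms(2) by blast
  have "path_component ?S v0 x" if "x \<in> ?S" for x
  proof -
    from that consider "x \<in> V" | u v where "penny_adj V u v" "x \<in> closed_segment u v"
      by (auto simp: penny_skeleton_def)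
    then show ?thesis
    proof cases
      case 1
      then show ?thesis using vv v0 assms(1) by (auto simp: penny_connected_def)
    next
      case 2
      then have "path_component ?S v0 u"
        using vv v0 assms(1) penny_adj_in(1)[OF 2(1)] by (auto simp: penny_connected_def)
      then show ?thesis using seg[OF 2(1) ends_in_segment(1) 2(2)] path_component_trans by blast
    qed
  qed
  then have "path_connected ?S"
    unfolding path_connected_component by (meson path_component_sym path_component_trans)
  then show ?thesis by (rule path_connected_imp_connected)
qed

section \<open>Edges of the graph are sides of triangles\<close>

text \<open>With \<open>a\<close> at coordinate \<open>0\<close> and \<open>b\<close> at coordinate \<open>1\<close> on their line, the interval \<open>(X, Y)\<close> meets
\<open>(0, 1)\<close> and neither interval contains an end of the other, so they agree.\<close>

lemma parallel_crossing_segments_aux: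
  fixes a b x y :: "'a::real_vector"
  assumes ab: "a \<noteq> b" and x: "x = a + X *\<^sub>R (b - a)" and y: "y = a + Y *\<^sub>R (b - a)"
    and s: "X < s" "s < Y" "0 < s" "s < 1"
    and free: "a \<notin> open_segment x y" "b \<notin> open_segment x y" "x \<notin> open_segment a b" "y \<notin> open_segment a b"
  shows "x = a \<and> y = b"
proof -
  have inside: "a + t *\<^sub>R (b - a) \<in> open_segment a b" if "0 < t" "t < 1" for t
    using that ab by (auto simp: in_segment algebra_simps intro!: exI[of _ t])
  have xy: "x \<noteq> y" using ab s by (simp add: x y)
  have between: "a + t *\<^sub>R (b - a) \<in> open_segment x y" if "X < t" "t < Y" for t
  proof -
    define \<tau> where "\<tau> = (t - X) / (Y - X)"
    have tau: "0 < \<tau>" "\<tau> < 1" "t = X + \<tau> * (Y - X)" using that by (auto simp: \<tau>_def field_simps)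
    have "a + t *\<^sub>R (b - a) = (1 - \<tau>) *\<^sub>R x + \<tau> *\<^sub>R y"
      unfolding x y tau(3) by (simp add: algebra_simps)
    then show ?thesis using tau xy by (auto simp: in_segment)
  qed
  have "\<not> 0 < X" using inside[of X] free(3) s x by auto
  moreover have "\<not> X < 0" using between[of 0] free(1) s by auto
  ultimately have X: "X = 0" by simp
  have "\<not> Y < 1" using inside[of Y] free(4) s y by auto
  moreover have "\<not> 1 < Y" using between[of 1] free(2) s by auto
  ultimately have "Y = 1" by simp
  then show ?thesis using X x y by simp
qed

lemma parallel_crossing_segments:
  fixes a b x y z :: "'a::real_vector"
  assumes z: "z \<in> open_segment a b" "z \<in> open_segment x y" and par: "y - x = \<alpha> *\<^sub>R (b - a)"
    and free: "a \<notin> open_segment x y" "b \<notin> open_segment x y" "x \<notin> open_segment a b" "y \<notin> open_segment a b"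
  shows "{x, y} = {a, b}"
proof -
  obtain s where s: "0 < s" "s < 1" "a \<noteq> b" "z = (1 - s) *\<^sub>R a + s *\<^sub>R b" using z(1) by (auto simp: in_segment)
  obtain l where l: "0 < l" "l < 1" "x \<noteq> y" "z = (1 - l) *\<^sub>R x + l *\<^sub>R y" using z(2) by (auto simp: in_segment)
  have z2: "z = x + l *\<^sub>R (y - x)" using l(4) by (simp add: algebra_simps)
  have za: "z = a + s *\<^sub>R (b - a)" using s(4) by (simp add: algebra_simps)
  have x: "x = a + (s - l * \<alpha>) *\<^sub>R (b - a)" using z2 za unfolding par by (simp add: algebra_simps)
  have "y = x + \<alpha> *\<^sub>R (b - a)" using par by (simp add: algebra_simps)
  then have y: "y = a + (s + (1 - l) * \<alpha>) *\<^sub>R (b - a)" unfolding x by (simp add: algebra_simps)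
  have "\<alpha> \<noteq> 0" using par l(3) by auto
  then consider "0 < \<alpha>" | "\<alpha> < 0" by linarith
  then show ?thesis
  proof cases
    case 1
    then have "x = a \<and> y = b"
      using l s by (intro parallel_crossing_segments_aux[OF s(3) x y _ _ s(1,2) free]) auto
    then show ?thesis by simp
  next
    case 2
    have "y = a \<and> x = b"
      using l s 2 free
      by (intro parallel_crossing_segments_aux[OF s(3) y x _ _ s(1,2)])
         (auto simp: open_segment_commute mult_neg_neg mult_less_0_iff zero_less_mult_iff)
    then show ?thesis by auto
  qed
qed

text \<open>A line through an inner point of a side enters the triangle unless it is parallel to that side.\<close>

lemma transversal_enters_triangle:
  fixes a b c z w :: "real^2"
  assumes nc: "\<not> collinear {a, b, c}" and cr: "cross2 (b - a) (c - a) \<noteq> 0"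
    and z: "z \<in> open_segment a b" and tr: "\<nexists>\<alpha>. w = \<alpha> *\<^sub>R (b - a)" and e: "0 < e"
  shows "\<exists>t. \<bar>t\<bar> < e \<and> z + t *\<^sub>R w \<in> interior (convex hull {a, b, c})"
proof -
  define k where "k = cross2 (b - a) (c - a)"
  define \<alpha> where "\<alpha> = cross2 w (c - a) / k"
  define \<beta> where "\<beta> = cross2 (b - a) w / k"
  have "k *\<^sub>R w = k *\<^sub>R (\<alpha> *\<^sub>R (b - a) + \<beta> *\<^sub>R (c - a))"
    using cross2_expand[of "b - a" "c - a" w] cr by (simp add: \<alpha>_def \<beta>_def k_def scaleR_right_distrib)
  then have w: "w = \<alpha> *\<^sub>R (b - a) + \<beta> *\<^sub>R (c - a)" using cr by (simp add: k_def)
  have \<beta>: "\<beta> \<noteq> 0" using tr w by auto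
  obtain s where s: "0 < s" "s < 1" "z = (1 - s) *\<^sub>R a + s *\<^sub>R b" using z by (auto simp: in_segment)
  define m where "m = min (min s (1 - s)) e"
  have m: "0 < m" "m \<le> s" "m \<le> 1 - s" "m \<le> e" using s e by (auto simp: m_def)
  \<comment> \<open>The sign makes the coefficient of \<open>c\<close> positive; the size keeps those of \<open>a\<close> and \<open>b\<close> positive.\<close>
  define t where "t = sgn \<beta> * (m / (2 * (\<bar>\<alpha>\<bar> + \<bar>\<beta>\<bar> + 1)))"
  have at: "\<bar>t\<bar> = m / (2 * (\<bar>\<alpha>\<bar> + \<bar>\<beta>\<bar> + 1))" using \<beta> m by (simp add: t_def abs_mult abs_sgn_eq)
  have "\<bar>t\<bar> * (\<bar>\<alpha>\<bar> + \<bar>\<beta>\<bar> + 1) = m / 2"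
    unfolding at using abs_ge_zero[of \<alpha>] abs_ge_zero[of \<beta>] by (simp add: field_simps)
  then have eq: "\<bar>t * \<alpha>\<bar> + \<bar>t * \<beta>\<bar> + \<bar>t\<bar> = m / 2" by (simp add: abs_mult algebra_simps)
  have tb: "0 < t * \<beta>"
  proof -
    have "t * \<beta> = \<bar>\<beta>\<bar> * (m / (2 * (\<bar>\<alpha>\<bar> + \<bar>\<beta>\<bar> + 1)))"
      by (simp add: t_def sgn_mult_abs[symmetric] abs_sgn)
    also have "0 < \<dots>" using \<beta> m by (intro mult_pos_pos divide_pos_pos) auto
    finally show ?thesis .
  qed
  have p: "0 < 1 - s - t * \<alpha> - t * \<beta>" "0 < s + t * \<alpha>" using eq m tb by linarith+
  have "z + t *\<^sub>R w = (1 - s - t * \<alpha> - t * \<beta>) *\<^sub>R a + (s + t * \<alpha>) *\<^sub>R b + (t * \<beta>) *\<^sub>R c"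
    unfolding s(3) w by (simp add: algebra_simps)
  moreover have "(1 - s - t * \<alpha> - t * \<beta>) + (s + t * \<alpha>) + t * \<beta> = 1" by simp
  ultimately have "\<exists>x y u. 0 < x \<and> 0 < y \<and> 0 < u \<and> x + y + u = 1 \<and> x *\<^sub>R a + y *\<^sub>R b + u *\<^sub>R c = z + t *\<^sub>R w"
    using p tb by metis
  then have "z + t *\<^sub>R w \<in> interior (convex hull {a, b, c})"
    by (subst interior_convex_hull_3_minimal[OF nc]) simp_all
  moreover have "\<bar>t\<bar> < e" using eq m by linarith
  ultimately show ?thesis by blast
qed

locale penny_triangulation =
  fixes V :: "(real^2) set" and \<T> :: "(real^2) set set" and C :: real and D :: nat
  assumes graph: "connected_penny_graph D V"
    and triangulation: "associated_triangulation C V \<T>"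
    and C_ge_1: "1 \<le> C"
begin

lemma separated: "unit_separated V"
  using graph by (auto simp: connected_penny_graph_def intro: penny_config_separated)

lemma infinite_V: "infinite V"
  using graph by (auto simp: connected_penny_graph_def infinite_penny_config_def)

lemma connected_V: "penny_connected V"
  using graph by (auto simp: connected_penny_graph_def)

lemma tri_cover: "\<exists>K\<in>\<T>. x \<in> convex hull K"
  using triangulation by (auto simp: associated_triangulation_def plane_triangulation_def) 

lemma tri_vertices: "K \<in> \<T> \<Longrightarrow> K \<subseteq> V" "v \<in> V \<Longrightarrow> \<exists>K\<in>\<T>. v \<in> K"
  using triangulation by (auto simp: associated_triangulation_def plane_triangulation_def)

lemma tri_meet: "K \<in> \<T> \<Longrightarrow> L \<in> \<T> \<Longrightarrow> convex hull K \<inter> convex hull L = convex hull (K \<inter> L)"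
  using triangulation by (auto simp: associated_triangulation_def plane_triangulation_def)

lemma tri_face:
  assumes "K \<in> \<T>"
  obtains \<sigma> where "\<sigma> \<in> penny_faces V" "interior (convex hull K) \<subseteq> \<sigma>"
    "\<And>v w. v \<in> K \<Longrightarrow> w \<in> K \<Longrightarrow> v \<noteq> w \<Longrightarrow> face_edge V \<sigma> v w \<or> face_diagonal V \<sigma> v w"
  using triangulation assms unfolding associated_triangulation_def triangulates_faces_def by metis

lemma closure_face:
  "\<sigma> \<in> penny_faces V \<Longrightarrow> closure \<sigma> = (\<Union>K\<in>{K\<in>\<T>. interior (convex hull K) \<subseteq> \<sigma>}. convex hull K)"
  using triangulation unfolding associated_triangulation_def triangulates_faces_def by blast

lemma tri_card: "K \<in> \<T> \<Longrightarrow> card K = 3" "K \<in> \<T> \<Longrightarrow> finite K" "K \<in> \<T> \<Longrightarrow> \<not> affine_dependent K"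
  using triangulation
  by (auto simp: associated_triangulation_def plane_triangulation_def intro: card_ge_0_finite)

lemma tri_dist: "K \<in> \<T> \<Longrightarrow> a \<in> K \<Longrightarrow> b \<in> K \<Longrightarrow> dist a b \<le> C"
proof (cases "a = b")
  case True
  then show ?thesis using C_ge_1 by simp
next
  case False
  assume K: "K \<in> \<T>" "a \<in> K" "b \<in> K"
  have "card (K - {a, b}) = 1" using K False tri_card by (simp add: card_Diff_subset)
  then obtain c where "K - {a, b} = {c}" by (auto simp: card_1_singleton_iff)
  then have "{a, b, c} \<in> \<T>" using K by (metis insert_Diff_single insert_absorb Diff_insert insert_Diff Diff_insert_absorb Un_insert_left insert_is_Un Un_Diff_cancel)
  then show ?thesis using triangulation by (auto simp: associated_triangulation_def)
qed

lemma triE: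
  assumes "K \<in> \<T>"
  obtains a b c where "K = {a, b, c}" "a \<noteq> b" "a \<noteq> c" "b \<noteq> c"
proof -
  obtain a b c where "K = {a, b, c}" "a \<noteq> b" "a \<noteq> c" "b \<noteq> c"
    using tri_card(1)[OF assms] by (auto simp: card_3_iff)
  then show thesis using that by blast
qed

lemma tri_shape:
  assumes K: "{a, b, c} \<in> \<T>" and ne: "a \<noteq> b" "a \<noteq> c" "b \<noteq> c"
  shows "\<not> collinear {a, b, c}" "sin (1 / C) \<le> \<bar>cross2 (b - a) (c - a)\<bar>"
proof -
  show "\<not> collinear {a, b, c}"
    using tri_card(3)[OF K] ne by (simp add: collinear_3_eq_affine_dependent)
  have *: "1 / C \<le> triangle_angle a b c \<and> 1 \<le> dist a b" if "{a, b, c} \<in> \<T>" for a b c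
    using triangulation that by (auto simp: associated_triangulation_def)
  show "sin (1 / C) \<le> \<bar>cross2 (b - a) (c - a)\<bar>"
    using *[of a b c] *[of b a c] *[of b c a] *[of a c b] K
    by (intro fat_triangle_cross2 C_ge_1) (auto simp: insert_commute)
qed

lemma sin_inverse_C_pos: "0 < sin (1 / C)"
proof (rule sin_gt_zero)
  show "0 < 1 / C" using C_ge_1 by simp
  have "1 / C \<le> 1" using C_ge_1 by simp
  then show "1 / C < pi" using pi_gt3 by linarith
qed

text \<open>Edges contain no further vertex because they have length \<open>1\<close>; diagonals contain none by definition.\<close>

lemma tri_side_free:
  assumes "K \<in> \<T>" "a \<in> K" "b \<in> K" "v \<in> V"
  shows "v \<notin> open_segment a b"
proof
  assume v: "v \<in> open_segment a b"
  then have "a \<noteq> b" by auto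
  then obtain \<sigma> where "face_edge V \<sigma> a b \<or> face_diagonal V \<sigma> a b" using tri_face[OF assms(1)] assms by metis
  then show False
  proof
    assume "face_edge V \<sigma> a b"
    then show False using edge_no_inner_vertex[OF separated _ v] assms(4) by (simp add: face_edge_def)
  next
    assume "face_diagonal V \<sigma> a b"
    then have "closed_segment a b \<inter> V = {a, b}" by (simp add: face_diagonal_def)
    then show False using v assms(4) by (auto simp: open_segment_def)
  qed
qed

lemma tri_interior_skeleton: "K \<in> \<T> \<Longrightarrow> interior (convex hull K) \<inter> penny_skeleton V = {}"
  by (erule tri_face) (auto simp: penny_faces_def dest: in_components_subset)

text \<open>An inner point \<open>z\<close> of an edge is not interior to a triangle, since the interior lies in a face.  So \<open>z\<close> lies on a
side, and the edge cannot cross that side transversally, since it would enter the interior.  Two overlapping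
segments neither of which contains an end of the other in its interior coincide.\<close>

lemma edge_is_side:
  assumes xy: "penny_adj V x y" and z: "z \<in> open_segment x y" and K: "K \<in> \<T>" "z \<in> convex hull K"
  shows "{x, y} \<subseteq> K"
proof -
  have zV: "z \<notin> V" using edge_no_inner_vertex[OF separated xy z] .
  have zs: "z \<in> penny_skeleton V"
    using edge_subset_skeleton[OF xy] z by (auto simp: open_segment_def)
  obtain a b c where abc: "K = {a, b, c}" "a \<noteq> b" "a \<noteq> c" "b \<noteq> c" using triE[OF K(1)] .
  have "z \<notin> interior (convex hull K)" using tri_interior_skeleton[OF K(1)] zs by blast
  then have "z \<in> frontier (convex hull K)" using K(2) by (simp add: frontier_def closure_subset[THEN subsetD])
  then have sides: "z \<in> closed_segment a b \<union> closed_segment b c \<union> closed_segment c a"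
    unfolding abc(1) by (simp add: frontier_of_triangle)
  have main: "{x, y} \<subseteq> K" if abc: "K = {a, b, c}" "a \<noteq> b" "a \<noteq> c" "b \<noteq> c" and zc: "z \<in> closed_segment a b" for a b c
  proof -
    have ab: "a \<in> V" "b \<in> V" using tri_vertices(1)[OF K(1)] abc by auto
    then have zo: "z \<in> open_segment a b" using zc zV by (auto simp: open_segment_def)
    have "\<exists>\<alpha>. y - x = \<alpha> *\<^sub>R (b - a)"
    proof (rule ccontr)
      assume no: "\<nexists>\<alpha>. y - x = \<alpha> *\<^sub>R (b - a)"
      obtain l where l: "0 < l" "l < 1" "z = (1 - l) *\<^sub>R x + l *\<^sub>R y" using z by (auto simp: in_segment)
      have "cross2 (b - a) (c - a) \<noteq> 0" using tri_shape(2)[of a b c] K(1) abc sin_inverse_C_pos by auto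
      then obtain t where t: "\<bar>t\<bar> < min l (1 - l)" "z + t *\<^sub>R (y - x) \<in> interior (convex hull {a, b, c})"
        using transversal_enters_triangle[OF tri_shape(1)[of a b c] _ zo no, of "min l (1 - l)"] K(1) abc l by auto
      have "z + t *\<^sub>R (y - x) = (1 - (l + t)) *\<^sub>R x + (l + t) *\<^sub>R y" unfolding l(3) by (simp add: algebra_simps)
      moreover have "0 \<le> l + t" "l + t \<le> 1" using t(1) by linarith+
      ultimately have "z + t *\<^sub>R (y - x) \<in> closed_segment x y" by (auto simp: in_segment)
      then show False using t(2) edge_subset_skeleton[OF xy] tri_interior_skeleton[OF K(1)] abc(1) by blast
    qed
    then obtain \<alpha> where "y - x = \<alpha> *\<^sub>R (b - a)" ..
    then have "{x, y} = {a, b}"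
      using edge_no_inner_vertex[OF separated xy] tri_side_free[OF K(1), of a b] abc ab penny_adj_in[OF xy]
      by (intro parallel_crossing_segments[OF zo z]) auto
    then show ?thesis using abc(1) by auto
  qed
  show ?thesis using sides main[of a b c] main[of b c a] main[of c a b] abc by (auto simp: insert_commute)
qed

end

section \<open>Existence and uniqueness of the interpolation\<close>

lemma affine_eq_on_hull:
  fixes a a' :: "'a::euclidean_space"
  assumes "\<And>v. v \<in> K \<Longrightarrow> a \<bullet> v + b = a' \<bullet> v + b'" "x \<in> convex hull K"
  shows "a \<bullet> x + b = a' \<bullet> x + b'"
proof -
  have eq: "a \<bullet> y + b = a' \<bullet> y + b' \<longleftrightarrow> (a - a') \<bullet> y = b' - b" for y
    by (auto simp: inner_diff_left algebra_simps)
  have "convex hull K \<subseteq> {y. (a - a') \<bullet> y = b' - b}"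
    by (rule hull_minimal) (use assms(1) eq convex_hyperplane in auto)
  then show ?thesis using assms(2) eq by blast
qed

lemma relpow_path_bound:
  fixes f :: "'a::metric_space \<Rightarrow> real"
  assumes "(v, w) \<in> R ^^ n"
    and step: "\<And>x y. (x, y) \<in> R \<Longrightarrow> \<bar>f x - f y\<bar> \<le> m" "\<And>x y. (x, y) \<in> R \<Longrightarrow> dist x y \<le> 1"
  shows "\<bar>f v - f w\<bar> \<le> real n * m \<and> dist v w \<le> real n"
  using assms(1)
proof (induction n arbitrary: w)
  case (Suc n)
  then obtain u where u: "(v, u) \<in> R ^^ n" "(u, w) \<in> R" by auto
  show ?case
    using Suc.IH[OF u(1)] step[OF u(2)] dist_triangle[of v w u] by (auto simp: algebra_simps)
qed auto

context penny_triangulation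
begin

lemma tri_hull_dist:
  assumes "K \<in> \<T>" "v \<in> K" "x \<in> convex hull K"
  shows "dist v x \<le> C"
proof -
  have "convex hull K \<subseteq> cball v C"
    by (rule hull_minimal) (use tri_dist[OF assms(1,2)] in auto)
  then show ?thesis using assms(3) by auto
qed

lemma finite_tri_near:
  assumes "bounded S"
  shows "finite {K \<in> \<T>. convex hull K \<inter> S \<noteq> {}}"
proof -
  obtain r where r: "0 < r" "S \<subseteq> cball 0 r"
    using assms by (auto simp: bounded_pos subset_iff)
  have "{K \<in> \<T>. convex hull K \<inter> S \<noteq> {}} \<subseteq> Pow (V \<inter> cball 0 (r + C))"
  proof (intro subsetI PowI)
    fix K v assume K: "K \<in> {K \<in> \<T>. convex hull K \<inter> S \<noteq> {}}" and v: "v \<in> K"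
    then obtain x where x: "x \<in> convex hull K" "x \<in> S" by auto
    have "dist v x \<le> C" using tri_hull_dist K v x by auto
    moreover have "norm x \<le> r" using r x by auto
    ultimately have "norm v \<le> r + C" using norm_triangle_sub[of v x] by (simp add: dist_norm)
    then show "v \<in> V \<inter> cball 0 (r + C)" using tri_vertices(1) K v by auto
  qed
  moreover have "finite (V \<inter> cball 0 (r + C))"
    using r C_ge_1 by (intro unit_separated_packing[OF separated]) simp
  ultimately show ?thesis by (meson finite_Pow_iff finite_subset)
qed

text \<open>The affine functions on the single triangles agree on common sides, because two triangles meet in the hull of
their common vertices, and the family of triangles is locally finite.\<close>

lemma interpolation_exists: "\<exists>g. is_interpolation V \<T> f g"
proof -
  have "\<forall>K\<in>\<T>. \<exists>p. \<forall>v\<in>K. fst p \<bullet> v + snd p = f v"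
  proof
    fix K assume K: "K \<in> \<T>"
    obtain a b c where abc: "K = {a, b, c}" "a \<noteq> b" "a \<noteq> c" "b \<noteq> c" using triE[OF K] .
    have "cross2 (b - a) (c - a) \<noteq> 0"
      using tri_shape(2)[of a b c] K abc sin_inverse_C_pos by auto
    from affine_through_triangle[OF this, of "f a" "f b" "f c"]
    show "\<exists>p. \<forall>v\<in>K. fst p \<bullet> v + snd p = f v" using abc(1) by auto
  qed
  then obtain P where P: "\<And>K v. K \<in> \<T> \<Longrightarrow> v \<in> K \<Longrightarrow> fst (P K) \<bullet> v + snd (P K) = f v" by metis
  define F where "F K x = fst (P K) \<bullet> x + snd (P K)" for K x
  have agree: "F K x = F L x" if "K \<in> \<T>" "L \<in> \<T>" "x \<in> convex hull K" "x \<in> convex hull L" for K L x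
  proof -
    have "x \<in> convex hull (K \<inter> L)" using tri_meet that by blast
    then show ?thesis unfolding F_def
      by (rule affine_eq_on_hull[rotated]) (use P that in auto)
  qed
  define g where "g x = F (SOME K. K \<in> \<T> \<and> x \<in> convex hull K) x" for x
  have gF: "g x = F K x" if K: "K \<in> \<T>" "x \<in> convex hull K" for K x
  proof -
    have "(SOME K. K \<in> \<T> \<and> x \<in> convex hull K) \<in> \<T> \<and> x \<in> convex hull (SOME K. K \<in> \<T> \<and> x \<in> convex hull K)"
      by (rule someI[of _ K]) (use K in simp)
    then show ?thesis unfolding g_def using agree K by blast
  qed
  have "continuous_map euclidean euclidean g"
  proof (rule pasting_lemma_locally_finite[where X = euclidean and I = \<T> and T = "\<lambda>K. convex hull K" and f = F])
    fix x :: "real^2"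
    show "\<exists>U. openin euclidean U \<and> x \<in> U \<and> finite {K \<in> \<T>. convex hull K \<inter> U \<noteq> {}}"
      using finite_tri_near[of "ball x 1"] by (intro exI[of _ "ball x 1"]) auto
    show "\<exists>K. K \<in> \<T> \<and> x \<in> convex hull K \<and> g x = F K x" using tri_cover[of x] gF by blast
  next
    fix K assume K: "K \<in> \<T>"
    show "closedin euclidean (convex hull K)"
      using tri_card(2)[OF K] by (simp add: finite_imp_compact_convex_hull compact_imp_closed)
    show "continuous_map (subtopology euclidean (convex hull K)) euclidean (F K)"
      unfolding continuous_map_iff_continuous F_def[abs_def] by (intro continuous_intros)
  next
    fix K L x assume "K \<in> \<T>" "L \<in> \<T>" "x \<in> topspace euclidean \<inter> convex hull K \<inter> convex hull L"
    then show "F K x = F L x" by (intro agree) auto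
  qed
  have "is_interpolation V \<T> f g"
    unfolding is_interpolation_def
  proof (intro conjI ballI)
    show "continuous_on UNIV g" using \<open>continuous_map euclidean euclidean g\<close> by simp
    show "g v = f v" if v: "v \<in> V" for v
    proof -
      obtain K where K: "K \<in> \<T>" "v \<in> K" using tri_vertices(2)[OF v] by blast
      then show ?thesis using gF[OF K(1), of v] P by (simp add: F_def hull_inc)
    qed
    show "\<exists>a b. \<forall>x\<in>convex hull K. g x = a \<bullet> x + b" if "K \<in> \<T>" for K
      using gF[OF that] unfolding F_def by blast
  qed
  then show ?thesis by (rule exI[where x = g])
qed

lemma interpolation_unique:
  assumes "is_interpolation V \<T> f g" "is_interpolation V \<T> f h"
  shows "g = h"
proof
  fix x
  obtain K where K: "K \<in> \<T>" "x \<in> convex hull K" using tri_cover by blast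
  obtain a b where g: "\<And>y. y \<in> convex hull K \<Longrightarrow> g y = a \<bullet> y + b"
    using assms(1) K(1) unfolding is_interpolation_def by blast
  obtain a' b' where h: "\<And>y. y \<in> convex hull K \<Longrightarrow> h y = a' \<bullet> y + b'"
    using assms(2) K(1) unfolding is_interpolation_def by blast
  have "a \<bullet> v + b = a' \<bullet> v + b'" if "v \<in> K" for v
  proof -
    have "v \<in> V" using tri_vertices(1)[OF K(1)] that by blast
    then have "g v = f v" "h v = f v" using assms unfolding is_interpolation_def by auto
    then show ?thesis using g h hull_inc[OF that] by metis
  qed
  then show "g x = h x" using affine_eq_on_hull[OF _ K(2)] g[OF K(2)] h[OF K(2)] by metis
qed

lemma is_interpolation_interpolation: "is_interpolation V \<T> f (interpolation V \<T> f)"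
proof -
  have "\<exists>!g. is_interpolation V \<T> f g"
    using interpolation_exists interpolation_unique by blast
  then show ?thesis unfolding interpolation_def by (rule theI')
qed

lemma interpolation_continuous: "continuous_on UNIV (interpolation V \<T> f)"
  and interpolation_vertex: "v \<in> V \<Longrightarrow> interpolation V \<T> f v = f v"
  and interpolation_affine:
    "K \<in> \<T> \<Longrightarrow> \<exists>a b. \<forall>x\<in>convex hull K. interpolation V \<T> f x = a \<bullet> x + b"
  using is_interpolation_interpolation[of f] unfolding is_interpolation_def by simp_all

section \<open>The boundary of a face\<close>

lemma open_face: "\<sigma> \<in> penny_faces V \<Longrightarrow> open \<sigma>"
  unfolding penny_faces_def
  by (rule open_components[OF open_Compl[OF closed_penny_skeleton[OF separated]]])

lemma face_skeleton: "\<sigma> \<in> penny_faces V \<Longrightarrow> \<sigma> \<inter> penny_skeleton V = {}"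
proof -
  assume "\<sigma> \<in> penny_faces V"
  then have "\<sigma> \<subseteq> - penny_skeleton V" unfolding penny_faces_def by (rule in_components_subset)
  then show ?thesis by blast
qed

lemma frontier_face_subset: "\<sigma> \<in> penny_faces V \<Longrightarrow> frontier \<sigma> \<subseteq> penny_skeleton V"
  unfolding penny_faces_def
  by (rule frontier_of_components_closed_complement[OF closed_penny_skeleton[OF separated]])

text \<open>The point \<open>z\<close> lies in a triangle of the face, and the edge through \<open>z\<close> is a side of this triangle.\<close>

lemma frontier_face_edge:
  assumes \<sigma>: "\<sigma> \<in> penny_faces V" and xy: "penny_adj V x y"
    and z: "z \<in> open_segment x y" "z \<in> frontier \<sigma>"
  shows "x \<in> frontier \<sigma> \<and> y \<in> frontier \<sigma>"
proof -
  have "z \<in> closure \<sigma>" using z(2) by (simp add: frontier_def)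
  then obtain K where K: "K \<in> \<T>" "interior (convex hull K) \<subseteq> \<sigma>" "z \<in> convex hull K"
    using closure_face[OF \<sigma>] by auto
  have sub: "convex hull K \<subseteq> closure \<sigma>" using closure_face[OF \<sigma>] K by blast
  have "{x, y} \<subseteq> K" using edge_is_side[OF xy z(1) K(1,3)] .
  then have "x \<in> closure \<sigma>" "y \<in> closure \<sigma>" using sub hull_inc[of _ K convex] by auto
  moreover have "x \<notin> \<sigma>" "y \<notin> \<sigma>"
    using face_skeleton[OF \<sigma>] penny_adj_in[OF xy] by (auto simp: penny_skeleton_def)
  ultimately show ?thesis using open_face[OF \<sigma>] by (simp add: frontier_def interior_open)
qed

text \<open>Every vertex on the boundary of a face is the apex of at least one of its corners.\<close>

lemma face_vertices_card:
  assumes \<sigma>: "\<sigma> \<in> penny_faces V"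
  shows "finite (face_vertices V \<sigma>)" "card (face_vertices V \<sigma>) \<le> D"
proof -
  have "facial_degree V \<sigma> \<le> (SUP \<sigma>\<in>penny_faces V. facial_degree V \<sigma>)"
    using \<sigma> by (rule SUP_upper)
  then have deg: "facial_degree V \<sigma> \<le> enat D" using graph by (simp add: connected_penny_graph_def)
  then have fin: "finite (face_corners V \<sigma>)" and card: "card (face_corners V \<sigma>) \<le> D"
    unfolding facial_degree_def by (auto split: if_splits)
  have sub: "face_vertices V \<sigma> \<subseteq> fst ` face_corners V \<sigma>"
  proof
    fix v assume v: "v \<in> face_vertices V \<sigma>"
    then have "v \<in> closure \<sigma>" by (simp add: face_vertices_def frontier_def)
    then obtain y where "y \<in> \<sigma>" "dist y v < 1/2"
      unfolding closure_approachable by (metis half_gt_zero zero_less_one)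
    then have "y \<in> \<sigma> \<inter> ball v (1/2)" by (simp add: dist_commute)
    then have "components (\<sigma> \<inter> ball v (1/2)) \<noteq> {}" unfolding components_eq_empty by blast
    then obtain S where "S \<in> components (\<sigma> \<inter> ball v (1/2))" by blast
    then have "(v, S) \<in> face_corners V \<sigma>" using v by (simp add: face_corners_def face_vertices_def)
    then show "v \<in> fst ` face_corners V \<sigma>" by force
  qed
  show "finite (face_vertices V \<sigma>)" using finite_subset[OF sub] fin by simp
  have "card (face_vertices V \<sigma>) \<le> card (fst ` face_corners V \<sigma>)" using card_mono[OF _ sub] fin by simp
  then show "card (face_vertices V \<sigma>) \<le> D" using card_image_le[OF fin, of fst] card by linarith
qed

text \<open>If two edges without a common end crossed, a triangle at the crossing point would have all four ends
as vertices.\<close>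

lemma disjoint_edges_disjoint:
  assumes e: "penny_adj V x y" "penny_adj V x' y'" and dis: "{x, y} \<inter> {x', y'} = {}"
  shows "closed_segment x y \<inter> closed_segment x' y' = {}"
proof (rule ccontr)
  assume "\<not> ?thesis"
  then obtain z where z: "z \<in> closed_segment x y" "z \<in> closed_segment x' y'" by blast
  have zV: "z \<notin> V"
  proof
    assume "z \<in> V"
    then have "z \<in> {x, y}" "z \<in> {x', y'}"
      using edge_no_inner_vertex[OF separated e(1), of z] edge_no_inner_vertex[OF separated e(2), of z] z
      by (auto simp: open_segment_def)
    then show False using dis by blast
  qed
  then have zo: "z \<in> open_segment x y" "z \<in> open_segment x' y'"
    using z penny_adj_in[OF e(1)] penny_adj_in[OF e(2)] by (auto simp: open_segment_def)
  obtain K where K: "K \<in> \<T>" "z \<in> convex hull K" using tri_cover by blast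
  have "{x, y} \<union> {x', y'} \<subseteq> K" using edge_is_side e zo K by blast
  then have "card ({x, y} \<union> {x', y'}) \<le> 3" using tri_card[OF K(1)] card_mono by metis
  moreover have "card ({x, y} \<union> {x', y'}) = 4"
    using dis e by (auto simp: penny_adj_def card_insert_if)
  ultimately show False by simp
qed

definition face_edges :: "(real^2) set \<Rightarrow> ((real^2) \<times> (real^2)) set" where
  "face_edges \<sigma> = {(x, y). x \<in> face_vertices V \<sigma> \<and> y \<in> face_vertices V \<sigma> \<and> penny_adj V x y}"

text \<open>Otherwise the vertices reachable from \<open>v\<close> and the remaining ones, each together with the edges among
them, would split the frontier of the face into two disjoint nonempty closed sets.  But the frontier of a
component of the complement of a connected set in the plane is connected.\<close>

lemma face_boundary_connected:
  assumes \<sigma>: "\<sigma> \<in> penny_faces V" and vw: "v \<in> face_vertices V \<sigma>" "w \<in> face_vertices V \<sigma>"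
  shows "(v, w) \<in> (face_edges \<sigma>)\<^sup>*"
proof (rule ccontr)
  assume no: "(v, w) \<notin> (face_edges \<sigma>)\<^sup>*"
  let ?A = "face_vertices V \<sigma>"
  define A1 where "A1 = {u \<in> ?A. (v, u) \<in> (face_edges \<sigma>)\<^sup>*}"
  define A2 where "A2 = ?A - A1"
  define F where "F B = B \<union> (\<Union>e\<in>{e\<in>B \<times> B. penny_adj V (fst e) (snd e)}. closed_segment (fst e) (snd e))" for B :: "(real^2) set"
  have finA: "finite ?A" using face_vertices_card[OF \<sigma>] by simp
  then have fin: "finite A1" "finite A2" by (auto simp: A1_def A2_def)
  have sep: "\<not> penny_adj V x y" if "x \<in> A1" "y \<in> A2" for x y
  proof
    assume "penny_adj V x y"
    then have "(x, y) \<in> face_edges \<sigma>" using that by (auto simp: face_edges_def A1_def A2_def)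
    then have "(v, y) \<in> (face_edges \<sigma>)\<^sup>*" using that(1) by (auto simp: A1_def intro: rtrancl_into_rtrancl)
    then show False using that(2) by (auto simp: A1_def A2_def)
  qed
  have AV: "?A \<subseteq> V" by (auto simp: face_vertices_def)
  have closed: "closed (F B)" if "finite B" for B
    unfolding F_def using that by (intro closed_Un finite_imp_closed closed_UN) auto
  have vtx: "u \<in> B" if "u \<in> F B" "u \<in> V" "B \<subseteq> V" for u B
    using that edge_no_inner_vertex[OF separated, of _ _ u] by (auto simp: F_def open_segment_def)
  have cover: "frontier \<sigma> \<subseteq> F A1 \<union> F A2"
  proof
    fix z assume z: "z \<in> frontier \<sigma>"
    show "z \<in> F A1 \<union> F A2"
    proof (cases "z \<in> V")
      case True
      then show ?thesis using z by (auto simp: F_def A1_def A2_def face_vertices_def)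
    next
      case False
      then obtain x y where xy: "penny_adj V x y" "z \<in> closed_segment x y"
        using frontier_face_subset[OF \<sigma>] z by (auto simp: penny_skeleton_def)
      then have "z \<in> open_segment x y" using False penny_adj_in by (auto simp: open_segment_def)
      then have "x \<in> ?A" "y \<in> ?A"
        using frontier_face_edge[OF \<sigma> xy(1) _ z] penny_adj_in[OF xy(1)] by (auto simp: face_vertices_def)
      then have "(x, y) \<in> A1 \<times> A1 \<or> (x, y) \<in> A2 \<times> A2"
        using sep[of x y] sep[of y x] xy(1) penny_adj_sym by (auto simp: A2_def)
      then show ?thesis using xy by (force simp: F_def)
    qed
  qed
  have disj: "F A1 \<inter> F A2 = {}"
  proof (rule ccontr)
    assume "F A1 \<inter> F A2 \<noteq> {}"
    then obtain z where z: "z \<in> F A1" "z \<in> F A2" by blast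
    have "A1 \<subseteq> V" "A2 \<subseteq> V" "A1 \<inter> A2 = {}" using AV by (auto simp: A1_def A2_def)
    show False
    proof (cases "z \<in> V")
      case True
      then show False using vtx z \<open>A1 \<subseteq> V\<close> \<open>A2 \<subseteq> V\<close> \<open>A1 \<inter> A2 = {}\<close> by blast
    next
      case False
      obtain x y where xy: "x \<in> A1" "y \<in> A1" "penny_adj V x y" "z \<in> closed_segment x y"
        using z(1) False \<open>A1 \<subseteq> V\<close> by (auto simp: F_def)
      obtain x' y' where xy': "x' \<in> A2" "y' \<in> A2" "penny_adj V x' y'" "z \<in> closed_segment x' y'"
        using z(2) False \<open>A2 \<subseteq> V\<close> by (auto simp: F_def)
      show False using disjoint_edges_disjoint[OF xy(3) xy'(3)] xy xy' \<open>A1 \<inter> A2 = {}\<close> by blast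
    qed
  qed
  have conn: "connected (frontier \<sigma>)"
    using connected_frontier_component_complement[of "penny_skeleton V" \<sigma>] \<sigma>
      connected_penny_skeleton[OF connected_V] infinite_V by (auto simp: penny_faces_def)
  have "v \<in> F A1 \<inter> frontier \<sigma>" using vw by (auto simp: F_def A1_def face_vertices_def)
  moreover have "w \<in> F A2 \<inter> frontier \<sigma>" using vw no by (auto simp: F_def A1_def A2_def face_vertices_def)
  ultimately show False
    using conn cover disj closed[OF fin(1)] closed[OF fin(2)] unfolding connected_closed by blast
qed

section \<open>Oscillation of the interpolation on a lattice cell\<close>

definition near_edges :: "real^2 \<Rightarrow> real \<Rightarrow> ((real^2) \<times> (real^2)) set" where
  "near_edges c r = {(x, y). penny_adj V x y \<and> dist c x \<le> r}"

lemma near_edges_subset: "near_edges c r \<subseteq> (V \<inter> cball c r) \<times> (V \<inter> cball c (r + 1))"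
proof clarify
  fix x y assume "(x, y) \<in> near_edges c r"
  then have a: "penny_adj V x y" "dist c x \<le> r" by (auto simp: near_edges_def)
  then show "x \<in> V \<inter> cball c r \<and> y \<in> V \<inter> cball c (r + 1)"
    using penny_adj_in[OF a(1)] penny_adj_dist[OF separated a(1)] dist_triangle[of c y x] by auto
qed

lemma finite_near_edges: "finite (near_edges c r)"
proof (cases "0 \<le> r")
  case True
  then have "finite ((V \<inter> cball c r) \<times> (V \<inter> cball c (r + 1)))"
    by (intro finite_cartesian_product unit_separated_packing[OF separated]) auto
  then show ?thesis using near_edges_subset finite_subset by blast
next
  case False
  then have "near_edges c r = {}"
    by (auto simp: near_edges_def dest: order_trans[OF zero_le_dist])
  then show ?thesis by simp
qed

definition edge_energy :: "(real^2 \<Rightarrow> real) \<Rightarrow> real^2 \<Rightarrow> real \<Rightarrow> real" where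
  "edge_energy f c r = (\<Sum>(x,y)\<in>near_edges c r. (f x - f y)\<^sup>2)"

lemma edge_energy_nonneg: "0 \<le> edge_energy f c r"
  unfolding edge_energy_def by (intro sum_nonneg) auto

lemma edge_energy_mono:
  assumes "dist c c' + r \<le> r'"
  shows "edge_energy f c r \<le> edge_energy f c' r'"
  unfolding edge_energy_def
proof (rule sum_mono2[OF finite_near_edges])
  show "near_edges c r \<subseteq> near_edges c' r'"
  proof clarify
    fix x y assume "(x, y) \<in> near_edges c r"
    then show "(x, y) \<in> near_edges c' r'"
      using assms dist_triangle[of c' x c] by (simp add: near_edges_def dist_commute)
  qed
qed auto

text \<open>The ends of a side of a triangle are vertices of one face, which has at most \<open>D\<close> vertices and hence at most
\<open>D\<^sup>2\<close> directed edges; a path along the boundary of the face has at most that many steps of length \<open>1\<close>.\<close>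

lemma triangle_difference_bound:
  assumes K: "K \<in> \<T>" "v \<in> K" "w \<in> K"
  shows "(f v - f w)\<^sup>2 \<le> (real D)^4 * edge_energy f v ((real D)\<^sup>2)"
proof (cases "v = w")
  case True
  then show ?thesis using edge_energy_nonneg by simp
next
  case False
  obtain \<sigma> where \<sigma>: "\<sigma> \<in> penny_faces V" "face_edge V \<sigma> v w \<or> face_diagonal V \<sigma> v w"
    using tri_face[OF K(1)] K(2,3) False by metis
  then have vw: "v \<in> face_vertices V \<sigma>" "w \<in> face_vertices V \<sigma>"
    using penny_adj_in by (auto simp: face_edge_def face_diagonal_def face_vertices_def)
  let ?A = "face_vertices V \<sigma>" and ?R = "face_edges \<sigma>"
  have finA: "finite ?A" "card ?A \<le> D" using face_vertices_card[OF \<sigma>(1)] by auto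
  have Rsub: "?R \<subseteq> ?A \<times> ?A" by (auto simp: face_edges_def)
  have finR: "finite ?R" using finite_subset[OF Rsub] finA by simp
  have "card ?R \<le> card ?A * card ?A" using card_mono[OF _ Rsub] finA by (simp add: card_cartesian_product)
  also have "\<dots> \<le> D * D" using finA by (intro mult_le_mono)
  finally have cR: "card ?R \<le> D\<^sup>2" by (simp add: power2_eq_square)
  define S where "S = (\<Sum>(x,y)\<in>?R. (f x - f y)\<^sup>2)"
  have S0: "0 \<le> S" unfolding S_def by (intro sum_nonneg) auto
  have step1: "\<bar>f x - f y\<bar> \<le> sqrt S" if "(x, y) \<in> ?R" for x y
  proof -
    have "(f x - f y)\<^sup>2 \<le> S"
      unfolding S_def using member_le_sum[OF that, of "\<lambda>(x,y). (f x - f y)\<^sup>2"] finR by auto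
    then show ?thesis using real_le_rsqrt[of "\<bar>f x - f y\<bar>" S] by simp
  qed
  have step2: "dist x y \<le> 1" if "(x, y) \<in> ?R" for x y
    using that penny_adj_dist[OF separated] by (auto simp: face_edges_def)
  have reach: "\<bar>f v - f u\<bar> \<le> (real D)\<^sup>2 * sqrt S \<and> dist v u \<le> (real D)\<^sup>2" if u: "u \<in> ?A" for u
  proof -
    have "(v, u) \<in> ?R\<^sup>*" using face_boundary_connected[OF \<sigma>(1) vw(1) u] .
    then obtain n where n: "n \<le> card ?R" "(v, u) \<in> ?R ^^ n"
      using rtrancl_finite_eq_relpow[OF finR] by auto
    then have "real n \<le> (real D)\<^sup>2" using cR by (metis (no_types) of_nat_le_iff of_nat_power le_trans)
    moreover have "\<bar>f v - f u\<bar> \<le> real n * sqrt S \<and> dist v u \<le> real n"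
      by (rule relpow_path_bound[OF n(2) step1 step2])
    moreover have "real n * sqrt S \<le> (real D)\<^sup>2 * sqrt S"
      using calculation(1) S0 by (intro mult_right_mono) auto
    ultimately show ?thesis by linarith
  qed
  have "\<bar>f v - f w\<bar>\<^sup>2 \<le> ((real D)\<^sup>2 * sqrt S)\<^sup>2"
    using reach[OF vw(2)] by (intro power_mono) auto
  then have "(f v - f w)\<^sup>2 \<le> (real D)^4 * S" using S0 by (simp add: power_mult_distrib)
  moreover have "S \<le> edge_energy f v ((real D)\<^sup>2)"
    unfolding S_def edge_energy_def
  proof (rule sum_mono2[OF finite_near_edges])
    show "?R \<subseteq> near_edges v ((real D)\<^sup>2)" using reach by (auto simp: face_edges_def near_edges_def)
  qed auto
  then have "(real D)^4 * S \<le> (real D)^4 * edge_energy f v ((real D)\<^sup>2)"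
    by (rule mult_left_mono) simp
  ultimately show ?thesis by linarith
qed

lemma interpolation_lipschitz_triangle:
  assumes K: "K \<in> \<T>" and M: "\<And>v w. v \<in> K \<Longrightarrow> w \<in> K \<Longrightarrow> \<bar>f v - f w\<bar> \<le> M"
    and xy: "x \<in> convex hull K" "y \<in> convex hull K"
  shows "\<bar>interpolation V \<T> f x - interpolation V \<T> f y\<bar> \<le> 2 * C / sin (1 / C) * M * dist x y"
proof -
  let ?g = "interpolation V \<T> f"
  obtain \<alpha> \<beta> where "\<forall>x\<in>convex hull K. ?g x = \<alpha> \<bullet> x + \<beta>"
    using interpolation_affine[OF K, of f] by (elim exE)
  then have g: "?g x = \<alpha> \<bullet> x + \<beta>" if "x \<in> convex hull K" for x using that by simp
  obtain a b c where abc: "K = {a, b, c}" "a \<noteq> b" "a \<noteq> c" "b \<noteq> c" using triE[OF K] .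
  have fv: "f v = \<alpha> \<bullet> v + \<beta>" if "v \<in> K" for v
    using g[OF hull_inc[OF that]] interpolation_vertex[of v f] tri_vertices(1)[OF K] that by auto
  have d: "\<bar>\<alpha> \<bullet> (b - a)\<bar> \<le> M" "\<bar>\<alpha> \<bullet> (c - a)\<bar> \<le> M"
    using M[of b a] M[of c a] fv[of a] fv[of b] fv[of c] abc by (auto simp: inner_diff_right)
  have n: "norm (b - a) \<le> C" "norm (c - a) \<le> C"
    using tri_dist[OF K, of b a] tri_dist[OF K, of c a] abc by (auto simp: dist_norm)
  have "sin (1 / C) * \<bar>\<alpha> \<bullet> (x - y)\<bar> \<le> \<bar>cross2 (b - a) (c - a)\<bar> * \<bar>\<alpha> \<bullet> (x - y)\<bar>"
    using tri_shape(2)[of a b c] K abc by (intro mult_right_mono) auto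
  also have "\<dots> \<le> norm (x - y) * (norm (c - a) * \<bar>\<alpha> \<bullet> (b - a)\<bar> + norm (b - a) * \<bar>\<alpha> \<bullet> (c - a)\<bar>)"
    by (rule gradient_bound)
  also have "\<dots> \<le> norm (x - y) * (C * M + C * M)"
    using d n C_ge_1 by (intro mult_left_mono add_mono mult_mono) auto
  finally have "sin (1 / C) * \<bar>\<alpha> \<bullet> (x - y)\<bar> \<le> 2 * C * M * dist x y" by (simp add: dist_norm algebra_simps)
  then have "\<bar>\<alpha> \<bullet> (x - y)\<bar> \<le> 2 * C * M * dist x y / sin (1 / C)"
    using sin_inverse_C_pos by (simp add: field_simps)
  then show ?thesis using g[OF xy(1)] g[OF xy(2)] by (simp add: inner_diff_right)
qed

text \<open>Along a segment the interpolation is continuous and Lipschitz on each of the finitely many pieces cut out by the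
triangles.\<close>

lemma interpolation_lipschitz_convex:
  assumes S: "convex S" "bounded S" and xy: "x \<in> S" "y \<in> S"
    and M: "\<And>K v w. K \<in> \<T> \<Longrightarrow> convex hull K \<inter> S \<noteq> {} \<Longrightarrow> v \<in> K \<Longrightarrow> w \<in> K \<Longrightarrow> \<bar>f v - f w\<bar> \<le> M"
  shows "\<bar>interpolation V \<T> f x - interpolation V \<T> f y\<bar> \<le> 2 * C / sin (1 / C) * M * dist x y"
proof -
  let ?g = "interpolation V \<T> f"
  define \<gamma> where "\<gamma> t = x + t *\<^sub>R (y - x)" for t :: real
  define L where "L = 2 * C / sin (1 / C) * M * dist x y"
  define I where "I = {K \<in> \<T>. convex hull K \<inter> S \<noteq> {}}"
  define U where "U K = {0..1} \<inter> \<gamma> -` (convex hull K)" for K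
  have \<gamma>S: "\<gamma> t \<in> S" if "t \<in> {0..1}" for t
    using convexD_alt[OF S(1) xy, of t] that by (simp add: \<gamma>_def algebra_simps)
  have \<gamma>c: "continuous_on UNIV \<gamma>" unfolding \<gamma>_def[abs_def] by (intro continuous_intros)
  obtain K0 where "K0 \<in> \<T>" "x \<in> convex hull K0" using tri_cover by blast
  moreover then obtain v where "v \<in> K0" by (metis convex_hull_eq_empty empty_iff equals0I)
  ultimately have M0: "0 \<le> M" using M[of K0 v v] xy by auto
  have L0: "0 \<le> L" unfolding L_def using M0 C_ge_1 sin_inverse_C_pos by simp
  have "L-lipschitz_on {0..1} (?g \<circ> \<gamma>)"
  proof (rule lipschitz_on_closed_Union[where U = U and I = I])
    show "finite I" unfolding I_def using finite_tri_near[OF S(2)] .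
    show "0 \<le> L" by (rule L0)
    show "closed (U K)" if "K \<in> I" for K
    proof -
      have "closed (convex hull K)"
        using that tri_card(2) by (auto simp: I_def finite_imp_compact_convex_hull compact_imp_closed)
      then show ?thesis unfolding U_def
        by (intro closed_Int closed_atLeastAtMost continuous_closed_vimage)
           (use \<gamma>c in \<open>auto simp: continuous_on_eq_continuous_at\<close>)
    qed
    show "{0..1} \<subseteq> (\<Union>K\<in>I. U K)"
    proof
      fix t :: real assume t: "t \<in> {0..1}"
      obtain K where "K \<in> \<T>" "\<gamma> t \<in> convex hull K" using tri_cover by blast
      then show "t \<in> (\<Union>K\<in>I. U K)" using t \<gamma>S[OF t] by (auto simp: I_def U_def)
    qed
    show "L-lipschitz_on (U K) (?g \<circ> \<gamma>)" if K: "K \<in> I" for K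
    proof (rule lipschitz_onI[OF _ L0])
      fix s t assume st: "s \<in> U K" "t \<in> U K"
      have "\<gamma> s - \<gamma> t = (s - t) *\<^sub>R (y - x)" by (simp add: \<gamma>_def algebra_simps)
      then have ds: "dist (\<gamma> s) (\<gamma> t) = dist s t * dist x y"
        by (simp add: dist_norm norm_minus_commute)
      have "\<bar>?g (\<gamma> s) - ?g (\<gamma> t)\<bar> \<le> 2 * C / sin (1 / C) * M * dist (\<gamma> s) (\<gamma> t)"
        by (rule interpolation_lipschitz_triangle) (use K M st in \<open>auto simp: I_def U_def\<close>)
      also have "\<dots> = L * dist s t" unfolding ds L_def by simp
      finally show "dist ((?g \<circ> \<gamma>) s) ((?g \<circ> \<gamma>) t) \<le> L * dist s t" by (simp add: dist_real_def)
    qed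
  qed
  from lipschitz_onD[OF this, of 0 1] show ?thesis
    by (simp add: \<gamma>_def dist_real_def L_def)
qed

lemma interpolation_cell_oscillation:
  assumes xy: "x \<in> lattice_cell p q" "y \<in> lattice_cell p q"
  shows "\<bar>interpolation V \<T> f x - interpolation V \<T> f y\<bar>
     \<le> 4 * C / sin (1 / C) * (real D)\<^sup>2 * sqrt (edge_energy f (lattice_point p q) (2 + C + (real D)\<^sup>2))"
proof -
  let ?c = "lattice_point p q"
  define M where "M = (real D)\<^sup>2 * sqrt (edge_energy f ?c (2 + C + (real D)\<^sup>2))"
  have M: "\<bar>f v - f w\<bar> \<le> M" if K: "K \<in> \<T>" "convex hull K \<inter> lattice_cell p q \<noteq> {}" "v \<in> K" "w \<in> K" for K v w
  proof -
    obtain z where z: "z \<in> convex hull K" "z \<in> lattice_cell p q" using K(2) by blast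
    have "dist v ?c \<le> C + 2"
      using tri_hull_dist[OF K(1,3) z(1)] lattice_cell_dist[OF z(2) lattice_cell_props(5)] dist_triangle[of v ?c z] by linarith
    then have "edge_energy f v ((real D)\<^sup>2) \<le> edge_energy f ?c (2 + C + (real D)\<^sup>2)"
      by (intro edge_energy_mono) simp
    then have "(real D)^4 * edge_energy f v ((real D)\<^sup>2) \<le> (real D)^4 * edge_energy f ?c (2 + C + (real D)\<^sup>2)"
      by (intro mult_left_mono) auto
    also have "\<dots> = M\<^sup>2" using edge_energy_nonneg by (simp add: M_def power_mult_distrib)
    finally have "(f v - f w)\<^sup>2 \<le> M\<^sup>2" using triangle_difference_bound[OF K(1,3,4), of f] by linarith
    moreover have "0 \<le> M" using edge_energy_nonneg by (simp add: M_def)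
    ultimately show ?thesis using abs_le_square_iff[of "f v - f w" M] by simp
  qed
  have M0: "0 \<le> M" using edge_energy_nonneg by (simp add: M_def)
  have "\<bar>interpolation V \<T> f x - interpolation V \<T> f y\<bar> \<le> 2 * C / sin (1 / C) * M * dist x y"
    by (rule interpolation_lipschitz_convex[OF lattice_cell_props(2,4) xy M])
  also have "\<dots> \<le> 2 * C / sin (1 / C) * M * 2"
    using lattice_cell_dist[OF xy] M0 C_ge_1 sin_inverse_C_pos by (intro mult_left_mono) auto
  finally show ?thesis by (simp add: M_def algebra_simps)
qed

end

section \<open>The maximum principle\<close>

lemma segment_crosses_square_boundary:
  assumes x: "\<bar>x$1 - p$1\<bar> \<le> real r" "\<bar>x$2 - p$2\<bar> \<le> real r"
    and y: "\<not> (\<bar>y$1 - p$1\<bar> \<le> real r \<and> \<bar>y$2 - p$2\<bar> \<le> real r)"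
  shows "\<exists>z\<in>closed_segment x y. z \<in> square_boundary p r"
proof -
  define a b :: "real^2" where "a = (\<chi> i. p$i - real r)" and "b = (\<chi> i. p$i + real r)"
  have Q: "u \<in> cbox a b \<longleftrightarrow> \<bar>u$1 - p$1\<bar> \<le> real r \<and> \<bar>u$2 - p$2\<bar> \<le> real r" for u
    by (auto simp: mem_box_cart forall_2 a_def b_def)
  have B: "u \<in> box a b \<longleftrightarrow> \<bar>u$1 - p$1\<bar> < real r \<and> \<bar>u$2 - p$2\<bar> < real r" for u
    by (auto simp: mem_box_cart forall_2 a_def b_def)
  have "closed_segment x y \<inter> frontier (cbox a b) \<noteq> {}"
  proof (rule connected_Int_frontier)
    show "closed_segment x y \<inter> cbox a b \<noteq> {}" using x Q by blast
    show "closed_segment x y - cbox a b \<noteq> {}" using y Q by blast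
  qed simp
  then obtain z where z: "z \<in> closed_segment x y" "z \<in> cbox a b - box a b"
    by (auto simp: frontier_cbox)
  then have "z \<in> square_boundary p r" using Q B by (auto simp: square_boundary_def)
  then show ?thesis using z by blast
qed

context penny_triangulation
begin

lemma interpolation_on_edge:
  assumes xy: "penny_adj V x y" and l: "0 \<le> l" "l \<le> 1"
  shows "interpolation V \<T> f ((1 - l) *\<^sub>R x + l *\<^sub>R y) = (1 - l) * f x + l * f y"
proof -
  have v: "interpolation V \<T> f x = f x" "interpolation V \<T> f y = f y"
    using interpolation_vertex[of _ f] penny_adj_in[OF xy] by auto
  consider "l = 0" | "l = 1" | "0 < l" "l < 1" using l by linarith
  then show ?thesis
  proof cases
    case 3
    define z where "z = (1 - l) *\<^sub>R x + l *\<^sub>R y"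
    have zo: "z \<in> open_segment x y"
      using 3 xy unfolding in_segment z_def penny_adj_def by blast
    obtain K where K: "K \<in> \<T>" "z \<in> convex hull K" using tri_cover by blast
    have "{x, y} \<subseteq> K" using edge_is_side[OF xy zo K] .
    then have h: "x \<in> convex hull K" "y \<in> convex hull K" using hull_inc[of _ K convex] by auto
    obtain a b where "\<forall>u\<in>convex hull K. interpolation V \<T> f u = a \<bullet> u + b"
      using interpolation_affine[OF K(1), of f] by (elim exE)
    then have "interpolation V \<T> f z = a \<bullet> z + b" "f x = a \<bullet> x + b" "f y = a \<bullet> y + b"
      using K(2) h v by auto
    then show ?thesis unfolding z_def[symmetric] by (simp add: z_def inner_add_right algebra_simps)
  qed (use v in simp_all)
qed

lemma interpolation_le_on_triangle:
  assumes K: "K \<in> \<T>" "x \<in> convex hull K" and le: "\<And>v. v \<in> K \<Longrightarrow> k * f v \<le> b"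
  shows "k * interpolation V \<T> f x \<le> b"
proof -
  obtain \<alpha> \<beta> where g: "\<forall>u\<in>convex hull K. interpolation V \<T> f u = \<alpha> \<bullet> u + \<beta>"
    using interpolation_affine[OF K(1), of f] by (elim exE)
  have "convex hull K \<subseteq> {u. (k *\<^sub>R \<alpha>) \<bullet> u \<le> b - k * \<beta>}"
  proof (rule hull_minimal)
    show "K \<subseteq> {u. (k *\<^sub>R \<alpha>) \<bullet> u \<le> b - k * \<beta>}"
    proof
      fix v assume v: "v \<in> K"
      have "f v = \<alpha> \<bullet> v + \<beta>"
        using g hull_inc[OF v, of convex] interpolation_vertex[of v f] tri_vertices(1)[OF K(1)] v by auto
      then show "v \<in> {u. (k *\<^sub>R \<alpha>) \<bullet> u \<le> b - k * \<beta>}" using le[OF v] by (simp add: algebra_simps)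
    qed
  qed (rule convex_halfspace_le)
  then have "k * (\<alpha> \<bullet> x) \<le> b - k * \<beta>" using K(2) by auto
  then show ?thesis using g K(2) by (simp add: algebra_simps)
qed

lemma finite_neighbours: "finite {y. penny_adj V x y}" "card {y. penny_adj V x y} \<le> 49"
proof -
  have sub: "{y. penny_adj V x y} \<subseteq> V \<inter> cball x 1"
    using penny_adj_dist[OF separated] penny_adj_in by auto
  have fin: "finite (V \<inter> cball x 1)" and card: "real (card (V \<inter> cball x 1)) \<le> (4 * 1 + 3)\<^sup>2"
    by (rule unit_separated_packing[OF separated]; simp)+
  show "finite {y. penny_adj V x y}" using finite_subset[OF sub fin] .
  have "real (card (V \<inter> cball x 1)) \<le> real 49" using card by simp
  then show "card {y. penny_adj V x y} \<le> 49" using card_mono[OF fin sub] by linarith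
qed

text \<open>At a vertex \<open>x\<close> of the square where \<open>k f\<close> takes its maximum over the vertices in the square, consider a neighbour \<open>y\<close>
outside.  The edge meets the boundary of the square at a point where the interpolation is smaller, and it is affine
along the edge, so \<open>k f y\<close> is smaller too.  By harmonicity all neighbours then have the value of \<open>x\<close>, so
they lie in the square, and by connectedness so does the whole infinite graph.  The factor \<open>k\<close> will be
\<open>1\<close> or \<open>-1\<close>.\<close>

lemma maximum_principle:
  assumes harm: "penny_harmonic V f"
    and bd: "\<And>z. z \<in> square_boundary p r \<Longrightarrow> k * interpolation V \<T> f z \<le> b"
    and v: "v \<in> V" "\<bar>v$1 - p$1\<bar> \<le> real r" "\<bar>v$2 - p$2\<bar> \<le> real r"
  shows "k * f v \<le> b"
proof (rule ccontr)
  assume "\<not> k * f v \<le> b"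
  define S where "S = {u \<in> V. \<bar>u$1 - p$1\<bar> \<le> real r \<and> \<bar>u$2 - p$2\<bar> \<le> real r}"
  have "S \<subseteq> V \<inter> cball p (2 * real r)"
  proof
    fix u assume "u \<in> S"
    then show "u \<in> V \<inter> cball p (2 * real r)"
      using norm_le_2_components[of "u - p"] by (auto simp: S_def dist_norm norm_minus_commute)
  qed
  moreover have "finite (V \<inter> cball p (2 * real r))" by (rule unit_separated_packing[OF separated]) simp
  ultimately have finS: "finite S" by (rule finite_subset)
  have vS: "v \<in> S" using v by (simp add: S_def)
  define m where "m = Max ((\<lambda>u. k * f u) ` S)"
  have mge: "k * f u \<le> m" if "u \<in> S" for u unfolding m_def using finS that by (intro Max_ge) auto
  have mb: "b < m" using mge[OF vS] \<open>\<not> k * f v \<le> b\<close> by linarith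
  have "m \<in> (\<lambda>u. k * f u) ` S" unfolding m_def using finS vS by (intro Max_in) auto
  then obtain x0 where x0: "x0 \<in> S" "k * f x0 = m" by auto
  have step: "y \<in> S \<and> k * f y = m" if x: "x \<in> S" "k * f x = m" and xy: "penny_adj V x y" for x y
  proof -
    have out: "k * f y < m" if y: "y \<notin> S" and xy: "penny_adj V x y" for y
    proof -
      obtain z where z: "z \<in> closed_segment x y" "z \<in> square_boundary p r"
        using segment_crosses_square_boundary[of x p r y] x(1) y penny_adj_in(2)[OF xy] by (auto simp: S_def)
      then obtain l where l: "0 \<le> l" "l \<le> 1" "z = (1 - l) *\<^sub>R x + l *\<^sub>R y" by (auto simp: in_segment)
      have "k * ((1 - l) * f x + l * f y) \<le> b"
        using bd[OF z(2)] interpolation_on_edge[OF xy l(1,2), of f] unfolding l(3) by simp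
      moreover have "k * ((1 - l) * f x + l * f y) = (1 - l) * m + l * (k * f y)"
        using x(2) by (simp add: algebra_simps)
      ultimately have *: "l * (k * f y) < l * m" using mb by (simp add: algebra_simps)
      then have "l \<noteq> 0" by auto
      then show ?thesis using * l(1) by simp
    qed
    have le: "k * f x - k * f u \<ge> 0" if "penny_adj V x u" for u
      using out[of u] mge[of u] that x(2) by fastforce
    have "(\<Sum>u | penny_adj V x u. f u - f x) = 0"
      using harm x(1) by (auto simp: penny_harmonic_def penny_laplacian_def S_def)
    moreover have "(\<Sum>u | penny_adj V x u. k * f x - k * f u) = - k * (\<Sum>u | penny_adj V x u. f u - f x)"
      by (simp add: sum_distrib_left algebra_simps)
    ultimately have "(\<Sum>u | penny_adj V x u. k * f x - k * f u) = 0" by simp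
    then have "\<forall>u\<in>{u. penny_adj V x u}. k * f x - k * f u = 0"
      using le by (subst (asm) sum_nonneg_eq_0_iff[OF finite_neighbours(1)]) blast+
    then have "k * f x - k * f y = 0" using xy by blast
    then show ?thesis using out[OF _ xy] x(2) by auto
  qed
  have "V \<subseteq> S"
  proof
    fix u assume u: "u \<in> V"
    have "(penny_adj V)\<^sup>*\<^sup>* x0 u" using connected_V u x0(1) by (simp add: penny_connected_def S_def)
    then have "u \<in> S \<and> k * f u = m"
      by (induction rule: rtranclp_induct) (use x0 step in blast)+
    then show "u \<in> S" by simp
  qed
  then show False using finS infinite_V finite_subset by blast
qed

section \<open>The energy of a harmonic function\<close>

text \<open>The Caccioppoli inequality with the radial cutoff that is \<open>1\<close> up to distance \<open>M\<close> and vanishes from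
distance \<open>2 M\<close> on.  The constant is \<open>392 = 2 * 4 * 49\<close>, where \<open>49\<close> bounds the degree.\<close>

lemma harmonic_energy_bound:
  assumes harm: "penny_harmonic V f" and M: "0 < M"
  shows "edge_energy f p M \<le> 392 / M\<^sup>2 * (\<Sum>v\<in>V \<inter> cball p (2 * M + 1). (f v)\<^sup>2)"
proof -
  define W where "W = V \<inter> cball p (2 * M + 1)"
  define \<phi> where "\<phi> x = max 0 (min 1 (2 - dist p x / M))" for x
  define P where "P = {(x, y). x \<in> W \<and> y \<in> W \<and> penny_adj V x y}"
  have finW: "finite W" unfolding W_def using M by (intro unit_separated_packing[OF separated]) simp
  have finP: "finite P" by (rule finite_subset[of _ "W \<times> W"]) (use finW in \<open>auto simp: P_def\<close>)
  have near: "\<bar>dist p x - dist p y\<bar> \<le> 1" if "penny_adj V x y" for x y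
    using penny_adj_dist[OF separated that] dist_triangle[of p x y] dist_triangle[of p y x]
    by (simp add: dist_commute)
  have supp: "dist p x < 2 * M" if "\<phi> x \<noteq> 0" for x
  proof (rule ccontr)
    assume "\<not> dist p x < 2 * M"
    then have "2 \<le> dist p x / M" using M by (simp add: field_simps)
    then show False using that by (simp add: \<phi>_def)
  qed
  have cac: "(\<Sum>(x,y)\<in>P. ((\<phi> x)\<^sup>2 + (\<phi> y)\<^sup>2) / 2 * (f x - f y)\<^sup>2)
    \<le> (\<Sum>(x,y)\<in>P. (\<phi> x - \<phi> y)\<^sup>2 * (f x + f y)\<^sup>2)"
    unfolding P_def
  proof (rule caccioppoli[OF finW])
    show "penny_adj V y x" if "penny_adj V x y" for x y using penny_adj_sym[OF that] .
    show "(\<Sum>y | penny_adj V x y. f y - f x) = 0" if "x \<in> W" for x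
      using harm that by (auto simp: penny_harmonic_def penny_laplacian_def W_def)
    show "{y. penny_adj V x y} \<subseteq> W" if "\<phi> x \<noteq> 0" for x
    proof clarify
      fix y assume xy: "penny_adj V x y"
      have "dist p y \<le> 2 * M + 1" using supp[OF that] near[OF xy] by linarith
      then show "y \<in> W" using penny_adj_in(2)[OF xy] by (simp add: W_def)
    qed
  qed
  have sub: "near_edges p M \<subseteq> P"
  proof clarify
    fix x y assume "(x, y) \<in> near_edges p M"
    then have xy: "penny_adj V x y" "dist p x \<le> M" by (auto simp: near_edges_def)
    then show "(x, y) \<in> P" using near[OF xy(1)] penny_adj_in[OF xy(1)] M by (auto simp: P_def W_def)
  qed
  have "1 / 2 * edge_energy f p M = (\<Sum>(x,y)\<in>near_edges p M. 1 / 2 * (f x - f y)\<^sup>2)"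
    by (simp add: edge_energy_def sum_distrib_left case_prod_unfold)
  also have "\<dots> \<le> (\<Sum>(x,y)\<in>near_edges p M. ((\<phi> x)\<^sup>2 + (\<phi> y)\<^sup>2) / 2 * (f x - f y)\<^sup>2)"
  proof (rule sum_mono, clarify)
    fix x y assume "(x, y) \<in> near_edges p M"
    then have "dist p x / M \<le> 1" using M by (simp add: near_edges_def)
    then have "\<phi> x = 1" by (simp add: \<phi>_def)
    then show "1 / 2 * (f x - f y)\<^sup>2 \<le> ((\<phi> x)\<^sup>2 + (\<phi> y)\<^sup>2) / 2 * (f x - f y)\<^sup>2"
      by (intro mult_right_mono) auto
  qed
  also have "\<dots> \<le> (\<Sum>(x,y)\<in>P. ((\<phi> x)\<^sup>2 + (\<phi> y)\<^sup>2) / 2 * (f x - f y)\<^sup>2)"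
    by (rule sum_mono2[OF finP sub]) auto
  also note cac
  also have "(\<Sum>(x,y)\<in>P. (\<phi> x - \<phi> y)\<^sup>2 * (f x + f y)\<^sup>2) \<le> (\<Sum>(x,y)\<in>P. 2 / M\<^sup>2 * (f x)\<^sup>2 + 2 / M\<^sup>2 * (f y)\<^sup>2)"
  proof (rule sum_mono, clarify)
    fix x y assume "(x, y) \<in> P"
    then have "(\<phi> x - \<phi> y)\<^sup>2 \<le> 1 / M\<^sup>2"
      unfolding \<phi>_def using near by (intro cutoff_lipschitz[OF M]) (auto simp: P_def)
    moreover have "(f x + f y)\<^sup>2 \<le> 2 * (f x)\<^sup>2 + 2 * (f y)\<^sup>2"
      using zero_le_power2[of "f x - f y"] by (simp add: power2_eq_square algebra_simps)
    ultimately have "(\<phi> x - \<phi> y)\<^sup>2 * (f x + f y)\<^sup>2 \<le> 1 / M\<^sup>2 * (2 * (f x)\<^sup>2 + 2 * (f y)\<^sup>2)"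
      by (intro mult_mono) auto
    then show "(\<phi> x - \<phi> y)\<^sup>2 * (f x + f y)\<^sup>2 \<le> 2 / M\<^sup>2 * (f x)\<^sup>2 + 2 / M\<^sup>2 * (f y)\<^sup>2"
      by (simp add: algebra_simps)
  qed
  also have "\<dots> = 2 / M\<^sup>2 * (\<Sum>(x,y)\<in>P. (f x)\<^sup>2) + 2 / M\<^sup>2 * (\<Sum>(x,y)\<in>P. (f y)\<^sup>2)"
    by (simp add: case_prod_unfold sum.distrib sum_distrib_left)
  also have "(\<Sum>(x,y)\<in>P. (f y)\<^sup>2) = (\<Sum>(x,y)\<in>P. (f x)\<^sup>2)"
    by (rule sum.reindex_bij_witness[of _ prod.swap prod.swap]) (auto simp: P_def penny_adj_sym)
  finally have "1 / 2 * edge_energy f p M \<le> 4 / M\<^sup>2 * (\<Sum>(x,y)\<in>P. (f x)\<^sup>2)" by simp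
  also have "\<dots> \<le> 4 / M\<^sup>2 * (49 * (\<Sum>x\<in>W. (f x)\<^sup>2))"
  proof (rule mult_left_mono)
    have "P = Sigma W (\<lambda>x. {y\<in>W. penny_adj V x y})" by (auto simp: P_def)
    then have "(\<Sum>(x,y)\<in>P. (f x)\<^sup>2) = (\<Sum>x\<in>W. \<Sum>y\<in>{y\<in>W. penny_adj V x y}. (f x)\<^sup>2)"
      using finW by (subst sum.Sigma) auto
    also have "\<dots> \<le> (\<Sum>x\<in>W. 49 * (f x)\<^sup>2)"
    proof (rule sum_mono)
      fix x
      have "card {y\<in>W. penny_adj V x y} \<le> card {y. penny_adj V x y}"
        by (rule card_mono[OF finite_neighbours(1)]) auto
      then have "real (card {y\<in>W. penny_adj V x y}) \<le> 49" using finite_neighbours(2)[of x] by linarith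
      then show "(\<Sum>y\<in>{y\<in>W. penny_adj V x y}. (f x)\<^sup>2) \<le> 49 * (f x)\<^sup>2"
        by (simp add: mult_right_mono)
    qed
    finally show "(\<Sum>(x,y)\<in>P. (f x)\<^sup>2) \<le> 49 * (\<Sum>x\<in>W. (f x)\<^sup>2)" by (simp add: sum_distrib_left)
  qed simp
  finally show ?thesis unfolding W_def by simp
qed

text \<open>Every vertex is charged to one triangle at it.  A point is covered by the triangles of boundedly many vertices,
since these vertices are within distance \<open>C\<close>.\<close>

lemma vertex_sum_le_integral:
  "(\<Sum>v\<in>V \<inter> cball p r. (f v)\<^sup>2)
     \<le> 68 / sin (1 / C) * (4 * C + 3)\<^sup>2 * (LINT y:cball p (r + C)|lborel. (interpolation V \<T> f y)\<^sup>2)"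
proof (cases "0 \<le> r")
  case False
  then have "cball p r = {}" by simp
  moreover have "0 \<le> (LINT y:cball p (r + C)|lborel. (interpolation V \<T> f y)\<^sup>2)"
    by (rule set_integral_nonneg_real) simp
  ultimately show ?thesis using sin_inverse_C_pos by simp
next
  case True
  let ?g = "interpolation V \<T> f"
  define s where "s = sin (1 / C)"
  have s: "0 < s" using sin_inverse_C_pos by (simp add: s_def)
  define T where "T v = (SOME K. K \<in> \<T> \<and> v \<in> K)" for v
  have T: "T v \<in> \<T>" "v \<in> T v" if "v \<in> V" for v
  proof -
    have "\<exists>K. K \<in> \<T> \<and> v \<in> K" using tri_vertices(2)[OF that] by blast
    from someI_ex[OF this] show "T v \<in> \<T>" "v \<in> T v" unfolding T_def by blast+
  qed
  have comp: "compact (convex hull (T v))" if "v \<in> V" for v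
    using T(1)[OF that] tri_card(2) by (simp add: finite_imp_compact_convex_hull)
  have gc: "continuous_on UNIV (\<lambda>x. (?g x)\<^sup>2)" by (intro continuous_intros interpolation_continuous)
  have one: "(f v)\<^sup>2 \<le> 68 / s * (LINT y:convex hull (T v)|lborel. (?g y)\<^sup>2)" if v: "v \<in> V" for v
  proof -
    obtain a b c where abc: "T v = {a, b, c}" "a \<noteq> b" "a \<noteq> c" "b \<noteq> c" using triE[OF T(1)[OF v]] .
    have "s / 2 \<le> measure lborel (convex hull (T v))"
      using tri_shape(2)[of a b c] T(1)[OF v] abc unfolding content_triangle_cross2 abc(1) s_def by simp
    then have "s / 2 * (f v)\<^sup>2 \<le> measure lborel (convex hull (T v)) * (f v)\<^sup>2" by (rule mult_right_mono) simp
    also have "\<dots> = measure lborel (convex hull (T v)) * (?g v)\<^sup>2" using interpolation_vertex[OF v] by simp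
    also have "\<dots> \<le> 34 * (LINT y:convex hull (T v)|lborel. (?g y)\<^sup>2)"
    proof -
      obtain \<alpha> \<beta> where "\<forall>u\<in>convex hull (T v). ?g u = \<alpha> \<bullet> u + \<beta>"
        using interpolation_affine[OF T(1)[OF v], of f] by (elim exE)
      then show ?thesis
        using affine_sq_le_mean_over_triangle[OF interpolation_continuous convex_convex_hull comp[OF v]]
          hull_inc[OF T(2)[OF v]] by blast
    qed
    finally show ?thesis using s by (simp add: field_simps)
  qed
  have fin: "finite (V \<inter> cball p r)" using True by (rule unit_separated_packing[OF separated])
  have "(\<Sum>v\<in>V \<inter> cball p r. (f v)\<^sup>2)
      \<le> (\<Sum>v\<in>V \<inter> cball p r. 68 / s * (LINT y:convex hull (T v)|lborel. (?g y)\<^sup>2))"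
    using one by (intro sum_mono) auto
  also have "\<dots> = 68 / s * (\<Sum>v\<in>V \<inter> cball p r. LINT y:convex hull (T v)|lborel. (?g y)\<^sup>2)"
    by (simp add: sum_distrib_left)
  finally have 1: "(\<Sum>v\<in>V \<inter> cball p r. (f v)\<^sup>2)
      \<le> 68 / s * (\<Sum>v\<in>V \<inter> cball p r. LINT y:convex hull (T v)|lborel. (?g y)\<^sup>2)" .
  have "(\<Sum>v\<in>V \<inter> cball p r. LINT y:convex hull (T v)|lborel. (?g y)\<^sup>2)
      \<le> (4 * C + 3)\<^sup>2 * (LINT y:cball p (r + C)|lborel. (?g y)\<^sup>2)"
  proof (rule sum_set_integral_le_multiplicity[OF gc _ fin])
    fix v assume v: "v \<in> V \<inter> cball p r"
    show "convex hull (T v) \<in> sets borel" using comp v by (simp add: borel_compact)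
    show "convex hull (T v) \<subseteq> cball p (r + C)"
    proof
      fix y assume y: "y \<in> convex hull (T v)"
      have "dist v y \<le> C" using tri_hull_dist[OF T y] v by auto
      then show "y \<in> cball p (r + C)" using v dist_triangle[of p y v] by auto
    qed
  next
    fix x
    have sub: "{v \<in> V \<inter> cball p r. x \<in> convex hull (T v)} \<subseteq> V \<inter> cball x C"
      using tri_hull_dist[OF T] by (auto simp: dist_commute)
    have "finite (V \<inter> cball x C)" "real (card (V \<inter> cball x C)) \<le> (4 * C + 3)\<^sup>2"
      using C_ge_1 by (intro unit_separated_packing[OF separated]; simp)+
    then show "real (card {v \<in> V \<inter> cball p r. x \<in> convex hull (T v)}) \<le> (4 * C + 3)\<^sup>2"
      using card_mono[OF _ sub] by (meson of_nat_mono order_trans)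
  qed auto
  then have "68 / s * (\<Sum>v\<in>V \<inter> cball p r. LINT y:convex hull (T v)|lborel. (?g y)\<^sup>2)
      \<le> 68 / s * ((4 * C + 3)\<^sup>2 * (LINT y:cball p (r + C)|lborel. (?g y)\<^sup>2))"
    using s by (intro mult_left_mono) auto
  then show ?thesis using 1 by (simp add: s_def mult.assoc)
qed

section \<open>The mean value inequality\<close>

text \<open>An edge is counted once for each lattice point within distance \<open>\<rho>\<close> of its first end.\<close>

lemma cell_energy_sum:
  assumes "0 \<le> \<rho>"
  shows "(\<Sum>q\<in>lattice_box n. edge_energy f (lattice_point p q) \<rho>)
     \<le> (2 * \<rho> + 1)\<^sup>2 * edge_energy f p (2 * real n + \<rho>)"
proof -
  let ?E = "near_edges p (2 * real n + \<rho>)" and ?h = "\<lambda>(x,y). (f x - f y)\<^sup>2"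
  have "(\<Sum>q\<in>lattice_box n. edge_energy f (lattice_point p q) \<rho>)
      = (\<Sum>q\<in>lattice_box n. \<Sum>e\<in>{e \<in> ?E. dist (lattice_point p q) (fst e) \<le> \<rho>}. ?h e)"
  proof (rule sum.cong[OF refl])
    fix q assume q: "q \<in> lattice_box n"
    have "near_edges (lattice_point p q) \<rho> = {e \<in> ?E. dist (lattice_point p q) (fst e) \<le> \<rho>}"
    proof (intro set_eqI iffI)
      fix e assume e: "e \<in> near_edges (lattice_point p q) \<rho>"
      then have "dist p (fst e) \<le> 2 * real n + \<rho>"
        using lattice_box_point_dist[OF q, of p] dist_triangle[of p "fst e" "lattice_point p q"]
        by (auto simp: near_edges_def)
      then show "e \<in> {e \<in> ?E. dist (lattice_point p q) (fst e) \<le> \<rho>}" using e by (auto simp: near_edges_def)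
    qed (auto simp: near_edges_def)
    then show "edge_energy f (lattice_point p q) \<rho> = (\<Sum>e\<in>{e \<in> ?E. dist (lattice_point p q) (fst e) \<le> \<rho>}. ?h e)"
      by (simp add: edge_energy_def)
  qed
  also have "\<dots> = (\<Sum>e\<in>?E. \<Sum>q\<in>{q \<in> lattice_box n. dist (lattice_point p q) (fst e) \<le> \<rho>}. ?h e)"
    by (rule sum.swap_restrict[OF finite_lattice_box finite_near_edges])
  also have "\<dots> \<le> (\<Sum>e\<in>?E. (2 * \<rho> + 1)\<^sup>2 * ?h e)"
  proof (rule sum_mono)
    fix e :: "(real^2) \<times> (real^2)"
    let ?Q = "{q \<in> lattice_box n. dist (lattice_point p q) (fst e) \<le> \<rho>}"
    define B where "B = {q::int\<times>int. \<bar>of_int (fst q) - (fst e $ 1 - p$1)\<bar> \<le> \<rho> \<and> \<bar>of_int (snd q) - (fst e $ 2 - p$2)\<bar> \<le> \<rho>}"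
    have sub: "?Q \<subseteq> B"
    proof
      fix q assume "q \<in> ?Q"
      then have d: "norm (lattice_point p q - fst e) \<le> \<rho>" by (simp add: dist_norm)
      show "q \<in> B"
        using component_le_norm_cart[of "lattice_point p q - fst e" 1]
          component_le_norm_cart[of "lattice_point p q - fst e" 2] d by (simp add: B_def algebra_simps)
    qed
    have B: "finite B" "real (card B) \<le> (2 * \<rho> + 1)\<^sup>2"
      unfolding B_def by (rule lattice_box_card[OF assms])+
    have "real (card ?Q) \<le> (2 * \<rho> + 1)\<^sup>2" using card_mono[OF B(1) sub] B(2) by linarith
    then show "(\<Sum>q\<in>?Q. ?h e) \<le> (2 * \<rho> + 1)\<^sup>2 * ?h e"
      by (simp add: mult_right_mono case_prod_unfold)
  qed
  also have "\<dots> = (2 * \<rho> + 1)\<^sup>2 * edge_energy f p (2 * real n + \<rho>)"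
    by (simp add: edge_energy_def sum_distrib_left)
  finally show ?thesis .
qed

lemma cell_integral_sum:
  "(\<Sum>q\<in>lattice_box n. LINT y:lattice_cell p q|lborel. (interpolation V \<T> f y)\<^sup>2)
     \<le> 4 * (LINT y:cball p (2 * real n + 2)|lborel. (interpolation V \<T> f y)\<^sup>2)"
proof (rule sum_set_integral_le_multiplicity[OF _ _ finite_lattice_box])
  show "continuous_on UNIV (\<lambda>x. (interpolation V \<T> f x)\<^sup>2)"
    by (intro continuous_intros interpolation_continuous)
  show "lattice_cell p q \<in> sets borel" for q by (rule lattice_cell_props)
  show "lattice_cell p q \<subseteq> cball p (2 * real n + 2)" if q: "q \<in> lattice_box n" for q
  proof
    fix y assume y: "y \<in> lattice_cell p q"
    show "y \<in> cball p (2 * real n + 2)"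
      using lattice_box_point_dist[OF q, of p] lattice_cell_dist[OF lattice_cell_props(5) y]
        dist_triangle[of p y "lattice_point p q"] by simp
  qed
  fix x :: "real^2"
  define B where "B = {q::int\<times>int. \<bar>of_int (fst q) - (x$1 - p$1 - 1/2)\<bar> \<le> 1/2 \<and> \<bar>of_int (snd q) - (x$2 - p$2 - 1/2)\<bar> \<le> 1/2}"
  have B: "finite B" "real (card B) \<le> (2 * (1/2) + 1)\<^sup>2" unfolding B_def by (rule lattice_box_card; simp)+
  have "{q \<in> lattice_box n. x \<in> lattice_cell p q} \<subseteq> B"
  proof
    fix q assume "q \<in> {q \<in> lattice_box n. x \<in> lattice_cell p q}"
    then have "x \<in> lattice_cell p q" by simp
    then show "q \<in> B" unfolding mem_lattice_cell B_def mem_Collect_eq abs_le_iff by linarith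
  qed
  from card_mono[OF B(1) this] B(2) show "real (card {q \<in> lattice_box n. x \<in> lattice_cell p q}) \<le> 4" by simp
qed auto

text \<open>The energy within this distance of a corner of a lattice cell controls the interpolation on the cell: \<open>2\<close>
bounds the diameter of the cell, \<open>C\<close> that of a triangle meeting it, and \<open>D\<^sup>2\<close> the length of a path along
a face.\<close>

definition face_scale :: real where "face_scale = 2 + C + (real D)\<^sup>2"

lemma square_mean_value:
  fixes p :: "real^2" and N :: nat and M R :: real
  assumes harm: "penny_harmonic V f" and N: "1 \<le> N" and M: "0 < M" "4 * real N + face_scale \<le> M"
    and R: "2 * M + 1 + C < R"
  defines "J \<equiv> (LINT y:ball p R|lborel. (interpolation V \<T> f y)\<^sup>2)"
  obtains r where "N \<le> r"
    "\<And>z. z \<in> square_boundary p r \<Longrightarrow> (interpolation V \<T> f z)\<^sup>2 \<le>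
       4 * J / (real N)\<^sup>2 + 8 * (4 * C / sin (1 / C) * (real D)\<^sup>2)\<^sup>2 * (2 * face_scale + 1)\<^sup>2
         * (392 / M\<^sup>2) * (68 / sin (1 / C) * (4 * C + 3)\<^sup>2) * J"
proof -
  let ?g = "interpolation V \<T> f"
  define L where "L = 4 * C / sin (1 / C) * (real D)\<^sup>2"
  define E where "E q = edge_energy f (lattice_point p q) face_scale" for q
  define I where "I q = (LINT y:lattice_cell p q|lborel. (?g y)\<^sup>2)" for q
  have gc: "continuous_on UNIV (\<lambda>x. (?g x)\<^sup>2)" by (intro continuous_intros interpolation_continuous)
  have fs: "3 \<le> face_scale" using C_ge_1 zero_le_power2[of "real D"] unfolding face_scale_def by linarith
  have Jmono: "(LINT y:cball p t|lborel. (?g y)\<^sup>2) \<le> J" if "t < R" for t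
    unfolding J_def by (rule set_integral_mono_set[OF gc]) (use that in auto)
  have J0: "0 \<le> J" unfolding J_def by (rule set_integral_nonneg_real) simp
  obtain r where r: "N \<le> r" "r < 2 * N" and
    bd: "\<And>z. z \<in> square_boundary p r \<Longrightarrow> (?g z)\<^sup>2 \<le> (\<Sum>q\<in>lattice_box (2 * N). I q) / (real N)\<^sup>2
        + 8 * (\<Sum>q\<in>lattice_box (2 * N). (L * sqrt (E q))\<^sup>2)"
  proof (rule good_square[where g = ?g and p = p and I = I and \<omega> = "\<lambda>q. L * sqrt (E q)", OF N])
    show "\<bar>?g x - ?g y\<bar> \<le> L * sqrt (E q)" if "x \<in> lattice_cell p q" "y \<in> lattice_cell p q" for q x y
      using interpolation_cell_oscillation[OF that, of f] by (simp add: L_def E_def face_scale_def)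
    show "a \<le> I q" if "\<And>y. y \<in> lattice_cell p q \<Longrightarrow> a \<le> (?g y)\<^sup>2" for q a
      using set_integral_ge_const[OF gc lattice_cell_props(4,3) that] by (simp add: I_def measure_lattice_cell)
    show "0 \<le> I q" for q unfolding I_def by (rule set_integral_nonneg_real) simp
  qed (use that in blast)
  have "(\<Sum>q\<in>lattice_box (2 * N). I q) \<le> 4 * (LINT y:cball p (2 * real (2 * N) + 2)|lborel. (?g y)\<^sup>2)"
    unfolding I_def by (rule cell_integral_sum)
  also have "\<dots> \<le> 4 * J" using M R fs C_ge_1 by (intro mult_left_mono Jmono) auto
  finally have Isum: "(\<Sum>q\<in>lattice_box (2 * N). I q) \<le> 4 * J" .
  have "edge_energy f p (2 * real (2 * N) + face_scale) \<le> edge_energy f p M"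
    using M by (intro edge_energy_mono) simp
  also have "\<dots> \<le> 392 / M\<^sup>2 * (\<Sum>v\<in>V \<inter> cball p (2 * M + 1). (f v)\<^sup>2)"
    by (rule harmonic_energy_bound[OF harm M(1)])
  also have "\<dots> \<le> 392 / M\<^sup>2 * (68 / sin (1 / C) * (4 * C + 3)\<^sup>2 * J)"
  proof (rule mult_left_mono)
    have "68 / sin (1 / C) * (4 * C + 3)\<^sup>2 * (LINT y:cball p (2 * M + 1 + C)|lborel. (?g y)\<^sup>2)
        \<le> 68 / sin (1 / C) * (4 * C + 3)\<^sup>2 * J"
      using sin_inverse_C_pos by (intro mult_left_mono Jmono[OF R]) simp
    then show "(\<Sum>v\<in>V \<inter> cball p (2 * M + 1). (f v)\<^sup>2) \<le> 68 / sin (1 / C) * (4 * C + 3)\<^sup>2 * J"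
      by (rule order_trans[OF vertex_sum_le_integral])
  qed simp
  finally have "(2 * face_scale + 1)\<^sup>2 * edge_energy f p (2 * real (2 * N) + face_scale)
      \<le> (2 * face_scale + 1)\<^sup>2 * (392 / M\<^sup>2 * (68 / sin (1 / C) * (4 * C + 3)\<^sup>2 * J))"
    by (rule mult_left_mono) simp
  moreover have "(\<Sum>q\<in>lattice_box (2 * N). E q)
      \<le> (2 * face_scale + 1)\<^sup>2 * edge_energy f p (2 * real (2 * N) + face_scale)"
    unfolding E_def using fs by (intro cell_energy_sum) simp
  ultimately have Esum: "(\<Sum>q\<in>lattice_box (2 * N). E q) \<le>
      (2 * face_scale + 1)\<^sup>2 * (392 / M\<^sup>2 * (68 / sin (1 / C) * (4 * C + 3)\<^sup>2 * J))" by linarith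
  have "(\<Sum>q\<in>lattice_box (2 * N). (L * sqrt (E q))\<^sup>2) = L\<^sup>2 * (\<Sum>q\<in>lattice_box (2 * N). E q)"
    by (simp add: power_mult_distrib E_def edge_energy_nonneg sum_distrib_left)
  also have "\<dots> \<le> L\<^sup>2 * ((2 * face_scale + 1)\<^sup>2 * (392 / M\<^sup>2 * (68 / sin (1 / C) * (4 * C + 3)\<^sup>2 * J)))"
    using Esum by (rule mult_left_mono) simp
  finally have wsum: "8 * (\<Sum>q\<in>lattice_box (2 * N). (L * sqrt (E q))\<^sup>2)
      \<le> 8 * L\<^sup>2 * (2 * face_scale + 1)\<^sup>2 * (392 / M\<^sup>2) * (68 / sin (1 / C) * (4 * C + 3)\<^sup>2) * J"
    by (simp add: mult.assoc)
  have "(\<Sum>q\<in>lattice_box (2 * N). I q) / (real N)\<^sup>2 \<le> 4 * J / (real N)\<^sup>2"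
    using Isum by (rule divide_right_mono) simp
  then show thesis using that[OF r(1)] bd wsum unfolding L_def[symmetric] by (meson add_mono order_trans)
qed

text \<open>With \<open>M = R/4\<close> and \<open>N\<close> about \<open>R/32\<close>, the cells of the box of size \<open>2 N\<close> and their surroundings fit
into the disk of radius \<open>M\<close>, and the vertices and triangles used to bound the energy there into that of radius \<open>R\<close>.
The lower bound on \<open>R\<close> also gives \<open>N \<ge> R/64\<close>, which puts a triangle containing \<open>p\<close> inside the square.
In the constant, \<open>16384 = 4 * 64\<^sup>2\<close> comes from \<open>N\<close> and \<open>50176 = 8 * 392 * 4\<^sup>2\<close> from \<open>M\<close>.\<close>

lemma mean_value_inequality:
  assumes harm: "penny_harmonic V f" and R: "64 + 64 * face_scale \<le> R"
  shows "(interpolation V \<T> f p)\<^sup>2 \<le>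
    (16384 + 50176 * (4 * C / sin (1 / C) * (real D)\<^sup>2)\<^sup>2 * (2 * face_scale + 1)\<^sup>2 * (68 / sin (1 / C) * (4 * C + 3)\<^sup>2))
      / R\<^sup>2 * (LINT y:ball p R|lborel. (interpolation V \<T> f y)\<^sup>2)"
proof -
  let ?g = "interpolation V \<T> f"
  define J where "J = (LINT y:ball p R|lborel. (?g y)\<^sup>2)"
  have J0: "0 \<le> J" unfolding J_def by (rule set_integral_nonneg_real) simp
  define A where "A = (4 * C / sin (1 / C) * (real D)\<^sup>2)\<^sup>2 * (2 * face_scale + 1)\<^sup>2 * (68 / sin (1 / C) * (4 * C + 3)\<^sup>2)"
  have fs: "3 \<le> face_scale" "2 + C \<le> face_scale"
    using C_ge_1 zero_le_power2[of "real D"] unfolding face_scale_def by linarith+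
  have R0: "0 < R" using R fs by linarith
  define N where "N = nat \<lfloor>R / 32\<rfloor>"
  have N: "real N \<le> R / 32" "R / 32 - 1 < real N" using R0 unfolding N_def by linarith+
  have N1: "1 \<le> N" using N(2) R fs by linarith
  have N2: "R / 64 \<le> real N" using N(2) R fs by linarith
  obtain r where r: "N \<le> r" and bd: "\<And>z. z \<in> square_boundary p r \<Longrightarrow> (?g z)\<^sup>2 \<le>
       4 * J / (real N)\<^sup>2 + 8 * (4 * C / sin (1 / C) * (real D)\<^sup>2)\<^sup>2 * (2 * face_scale + 1)\<^sup>2
         * (392 / (R / 4)\<^sup>2) * (68 / sin (1 / C) * (4 * C + 3)\<^sup>2) * J"
    unfolding J_def
    by (rule square_mean_value[OF harm N1, of "R / 4" R p]) (use R0 R fs N C_ge_1 in auto)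
  define B where "B = (16384 + 50176 * A) / R\<^sup>2 * J"
  have "4 * J / (real N)\<^sup>2 \<le> 4 * J / (R / 64)\<^sup>2"
    using J0 R0 N2 by (intro divide_left_mono power_mono mult_pos_pos) auto
  moreover have "4 * J / (R / 64)\<^sup>2 + 8 * (4 * C / sin (1 / C) * (real D)\<^sup>2)\<^sup>2 * (2 * face_scale + 1)\<^sup>2
         * (392 / (R / 4)\<^sup>2) * (68 / sin (1 / C) * (4 * C + 3)\<^sup>2) * J = B"
  proof -
    have "4 * J / (R / 64)\<^sup>2 + 8 * a * b * (392 / (R / 4)\<^sup>2) * c * J = (16384 + 50176 * (a * b * c)) / R\<^sup>2 * J"
      for a b c :: real
      using R0 by (simp add: power_divide field_simps)
    then show ?thesis unfolding B_def A_def .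
  qed
  ultimately have bdB: "(?g z)\<^sup>2 \<le> B" if "z \<in> square_boundary p r" for z
    using bd[OF that] by linarith
  have B0: "0 \<le> B"
    unfolding B_def A_def using J0 sin_inverse_C_pos by (intro mult_nonneg_nonneg divide_nonneg_nonneg add_nonneg_nonneg) auto
  have bds: "\<bar>?g z\<bar> \<le> sqrt B" if "z \<in> square_boundary p r" for z
    using real_sqrt_le_mono[OF bdB[OF that]] by simp
  obtain K where K: "K \<in> \<T>" "p \<in> convex hull K" using tri_cover by blast
  have rC: "C \<le> real r" using r N2 R fs by linarith
  have side: "k * ?g p \<le> sqrt B" if k: "\<bar>k\<bar> = 1" for k
  proof (rule interpolation_le_on_triangle[OF K])
    fix v assume v: "v \<in> K"
    have "norm (v - p) \<le> real r" using tri_hull_dist[OF K(1) v K(2)] rC by (simp add: dist_norm)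
    then have c: "\<bar>v$1 - p$1\<bar> \<le> real r" "\<bar>v$2 - p$2\<bar> \<le> real r"
      using component_le_norm_cart[of "v - p" 1] component_le_norm_cart[of "v - p" 2] by auto
    show "k * f v \<le> sqrt B"
    proof (rule maximum_principle[OF harm _ _ c])
      show "v \<in> V" using tri_vertices(1)[OF K(1)] v by blast
      fix z assume "z \<in> square_boundary p r"
      then have "\<bar>k * ?g z\<bar> \<le> sqrt B" using bds k by (simp add: abs_mult)
      then show "k * ?g z \<le> sqrt B" by linarith
    qed
  qed
  have "\<bar>?g p\<bar> \<le> sqrt B" using side[of 1] side[of "-1"] by simp
  then have "\<bar>?g p\<bar>\<^sup>2 \<le> (sqrt B)\<^sup>2" by (intro power_mono) auto
  then have "(?g p)\<^sup>2 \<le> B" using B0 by simp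
  then show ?thesis unfolding B_def A_def J_def by (simp add: mult.assoc)
qed

end

theorem theorem1p3:
  fixes C0 :: "nat \<Rightarrow> real"
  assumes C0_ge_1: "\<And>D. 1 \<le> C0 D"
    and C0_admissible:
      "\<And>D V. connected_penny_graph D V \<Longrightarrow> \<exists>\<T>. associated_triangulation (C0 D) V \<T>"
  shows "\<forall>D::nat. \<exists>R1 C1 :: real. \<forall>V \<T>.
           connected_penny_graph D V \<longrightarrow> associated_triangulation (C0 D) V \<T> \<longrightarrow>
           (\<forall>R p f. R1 \<le> R \<longrightarrow> penny_harmonic V f \<longrightarrow>
              (interpolation V \<T> f p)\<^sup>2
                \<le> C1 / R\<^sup>2 * (LINT y:ball p R|lborel. (interpolation V \<T> f y)\<^sup>2))"
proof
  fix D :: nat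
  define F where "F = 2 + C0 D + (real D)\<^sup>2"
  show "\<exists>R1 C1 :: real. \<forall>V \<T>.
           connected_penny_graph D V \<longrightarrow> associated_triangulation (C0 D) V \<T> \<longrightarrow>
           (\<forall>R p f. R1 \<le> R \<longrightarrow> penny_harmonic V f \<longrightarrow>
              (interpolation V \<T> f p)\<^sup>2
                \<le> C1 / R\<^sup>2 * (LINT y:ball p R|lborel. (interpolation V \<T> f y)\<^sup>2))"
  proof (rule exI[of _ "64 + 64 * F"],
      rule exI[of _ "16384 + 50176 * (4 * C0 D / sin (1 / C0 D) * (real D)\<^sup>2)\<^sup>2 * (2 * F + 1)\<^sup>2
        * (68 / sin (1 / C0 D) * (4 * C0 D + 3)\<^sup>2)"], intro allI impI)
    fix V \<T> R p f
    assume "connected_penny_graph D V" "associated_triangulation (C0 D) V \<T>"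
    then interpret penny_triangulation V \<T> "C0 D" D by unfold_locales (auto intro: C0_ge_1)
    assume R: "64 + 64 * F \<le> R" and f: "penny_harmonic V f"
    have F: "F = face_scale" by (simp add: F_def face_scale_def)
    show "(interpolation V \<T> f p)\<^sup>2
      \<le> (16384 + 50176 * (4 * C0 D / sin (1 / C0 D) * (real D)\<^sup>2)\<^sup>2 * (2 * F + 1)\<^sup>2
        * (68 / sin (1 / C0 D) * (4 * C0 D + 3)\<^sup>2)) / R\<^sup>2
        * (LINT y:ball p R|lborel. (interpolation V \<T> f y)\<^sup>2)"
      using mean_value_inequality[OF f R[unfolded F]] unfolding F .
  qed
qed

end
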